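(* Let $\mathbb{K}$ be an algebraically closed field and let $q\in\mathbb{K}$ be nonzero and not a root of $1$. Let $V$ denote a finite-dimensional irreducible $\boxtimes_q$-module of type $1$. Then there exists a unique $\mathcal{A}_q$-module structure on $V$ such that the standard generators $x$ and $y$ of $\mathcal{A}_q$ act on $V$ as $x_{01}$ and $x_{23}$ respectively. This $\mathcal{A}_q$-module is NonNil, irreducible, and of type $(1,1)$.
   Context: Let $[n]_q=\frac{q^n-q^{-n}}{q-q^{-1}}$ and $\mathbb{Z}_4=\mathbb{Z}/4\mathbb{Z}$. The $q$-tetrahedron algebra $\boxtimes_q$ is the unital associative $\mathbb{K}$-algebra with generators $\{x_{ij}\mid i,j\in\mathbb{Z}_4,\ j-i=1\text{ or }j-i=2\}$ and relations: (i) for $i,j\in\mathbb{Z}_4$ with $j-i=2$, $x_{ij}x_{ji}=1$; (ii) for $h,i,j\in\mathbb{Z}_4$ such that $(i-h,j-i)$ is one of $(1,1),(1,2),(2,1)$, $\frac{q x_{hi}x_{ij}-q^{-1}x_{ij}x_{hi}}{q-q^{-1}}=1$; (iii) for $h,i,j,k\in\mathbb{Z}_4$ with $i-h=j-i=k-j=1$, $x_{hi}^3x_{jk}-[3]_q x_{hi}^2x_{jk}x_{hi}+[3]_q x_{hi}x_{jk}x_{hi}^2-x_{jk}x_{hi}^3=0$. $\mathcal{A}_q$ is the unital associative $\mathbb{K}$-algebra with generators $x,y$ (the standard generators) and relations $x^3y-[3]_q x^2yx+[3]_q xyx^2-yx^3=0$ and $y^3x-[3]_q y^2xy+[3]_q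 yxy^2-xy^3=0$. Irreducible modules are nonzero. For every finite-dimensional irreducible $\boxtimes_q$-module $V$ there exist an integer $d\ge 0$ (the diameter) and a scalar $\varepsilon\in\{1,-1\}$ (the type of $V$) such that every generator $x_{ij}$ acts semisimply (diagonalizably) on $V$ with set of distinct eigenvalues $\{\varepsilon q^{d-2n}\mid 0\le n\le d\}$. A finite-dimensional $\mathcal{A}_q$-module $V$ is NonNil if neither $x$ nor $y$ acts nilpotently on $V$. For a NonNil finite-dimensional irreducible $\mathcal{A}_q$-module $V$ it is known that $x,y$ are semisimple on $V$ and there exist an integer $d\ge0$ and nonzero $\alpha,\alpha^*\in\mathbb{K}$ such that the set of distinct eigenvalues of $x$ (resp. $y$) on $V$ is $\{\alpha q^{d-2n}\mid 0\le n\le d\}$ (resp. $\{\alpha^* q^{d-2n}\mid 0\le n\le d\}$); the pair $(\alpha,\alpha^* )$ is called the type of $V$. *)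

theory Defs
  imports
    "HOL-Library.FuncSet"
    "HOL-Library.Numeral_Type"
    "HOL-Library.Poly_Mapping"
    "HOL-Algebra.QuotRing"
    "HOL-Algebra.Module"
    "HOL-Algebra.Algebraic_Closure_Type"
begin

section \<open>Algebras presented by generators and relations\<close>

text \<open>
  The free monoid on \<open>'g\<close>, written additively because \<^type>\<open>poly_mapping\<close> forms its convolution
  product over a \<^class>\<open>monoid_add\<close>.  This makes the type of finitely supported functions from
  words to the field the free unital associative algebra on \<open>'g\<close>.
\<close>

datatype 'g word = Word (letters: "'g list")

instantiation word :: (type) monoid_add
begin

definition "0 = Word []"

definition "v + w = Word (letters v @ letters w)"

instance
  by standard (simp_all add: zero_word_def plus_word_def)

end

type_synonym ('g, 'k) free_alg = "'g word \<Rightarrow>\<^sub>0 'k"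

definition fscalar :: "'k \<Rightarrow> ('g, 'k::field) free_alg" where
  "fscalar c = Poly_Mapping.single 0 c"

definition fgen :: "'g \<Rightarrow> ('g, 'k::field) free_alg" where
  "fgen g = Poly_Mapping.single (Word [g]) 1"

text \<open>
  The library's \<open>ideal\<close> and \<open>Idl\<close> are two-sided.  A set of relators
  \<open>S\<close> imposes \<open>s = 0\<close> for each \<open>s \<in> S\<close>.
\<close>

definition relator_ideal :: "('g, 'k::field) free_alg set \<Rightarrow> ('g, 'k) free_alg set" where
  "relator_ideal S = Idl\<^bsub>ring_of_type_algebra\<^esub> S"

definition relator_class :: "('g, 'k::field) free_alg set \<Rightarrow> ('g, 'k) free_alg \<Rightarrow> ('g, 'k) free_alg set" where
  "relator_class S a = a_r_coset ring_of_type_algebra (relator_ideal S) a"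

definition presented_algebra ::
  "('g, 'k::field) free_alg set \<Rightarrow> ('k, ('g, 'k) free_alg set) module" where
  "presented_algebra S =
     ring.extend (ring_of_type_algebra Quot relator_ideal S)
       (module.fields (\<lambda>c C. \<Union>a\<in>C. relator_class S (fscalar c * a)))"

definition presented_gen :: "('g, 'k::field) free_alg set \<Rightarrow> 'g \<Rightarrow> ('g, 'k) free_alg set" where
  "presented_gen S g = relator_class S (fgen g)"


section \<open>Modules over a (not necessarily commutative) algebra\<close>

text \<open>
  The library's \<open>module\<close> locales require a commutative ring of scalars.  A module structure on the
  \<open>'k\<close>-space \<open>(UNIV, scale)\<close> is here a unital \<open>'k\<close>-algebra homomorphism from \<open>A\<close> to the linear
  endomorphisms.  The extensional function space fixes its values off the carrier of \<open>A\<close>,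
  so that two module structures are equal iff they agree on \<open>A\<close>.
\<close>

definition algebra_module ::
  "('k::field, 'a, 'm) module_scheme \<Rightarrow> ('k \<Rightarrow> 'v::ab_group_add \<Rightarrow> 'v) \<Rightarrow> ('a \<Rightarrow> 'v \<Rightarrow> 'v) \<Rightarrow> bool" where
  "algebra_module A scale act \<longleftrightarrow>
     vector_space scale \<and>
     act \<in> carrier A \<rightarrow>\<^sub>E {f. Vector_Spaces.linear scale scale f} \<and>
     act \<one>\<^bsub>A\<^esub> = id \<and>
     (\<forall>a\<in>carrier A. \<forall>b\<in>carrier A. act (a \<otimes>\<^bsub>A\<^esub> b) = act a \<circ> act b) \<and>
     (\<forall>a\<in>carrier A. \<forall>b\<in>carrier A. act (a \<oplus>\<^bsub>A\<^esub> b) = (\<lambda>v. act a v + act b v)) \<and>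
     (\<forall>c. \<forall>a\<in>carrier A. act (c \<odot>\<^bsub>A\<^esub> a) = (\<lambda>v. scale c (act a v)))"

definition submodule_of ::
  "('k::field, 'a, 'm) module_scheme \<Rightarrow> ('k \<Rightarrow> 'v::ab_group_add \<Rightarrow> 'v) \<Rightarrow> ('a \<Rightarrow> 'v \<Rightarrow> 'v) \<Rightarrow> 'v set \<Rightarrow> bool" where
  "submodule_of A scale act W \<longleftrightarrow>
     module.subspace scale W \<and> (\<forall>a\<in>carrier A. \<forall>w\<in>W. act a w \<in> W)"

definition irreducible_module ::
  "('k::field, 'a, 'm) module_scheme \<Rightarrow> ('k \<Rightarrow> 'v::ab_group_add \<Rightarrow> 'v) \<Rightarrow> ('a \<Rightarrow> 'v \<Rightarrow> 'v) \<Rightarrow> bool" where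
  "irreducible_module A scale act \<longleftrightarrow>
     algebra_module A scale act \<and> (UNIV :: 'v set) \<noteq> {0} \<and>
     (\<forall>W. submodule_of A scale act W \<longrightarrow> W = {0} \<or> W = UNIV)"

definition finite_dimensional :: "('k::field \<Rightarrow> 'v::ab_group_add \<Rightarrow> 'v) \<Rightarrow> bool" where
  "finite_dimensional scale \<longleftrightarrow> (\<exists>B. finite_dimensional_vector_space scale B)"

definition eigenvalues :: "('k::field \<Rightarrow> 'v::ab_group_add \<Rightarrow> 'v) \<Rightarrow> ('v \<Rightarrow> 'v) \<Rightarrow> 'k set" where
  "eigenvalues scale f = {c. \<exists>v. v \<noteq> 0 \<and> f v = scale c v}"

definition diagonalizable :: "('k::field \<Rightarrow> 'v::ab_group_add \<Rightarrow> 'v) \<Rightarrow> ('v \<Rightarrow> 'v) \<Rightarrow> bool" where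
  "diagonalizable scale f \<longleftrightarrow> module.span scale {v. \<exists>c. f v = scale c v} = UNIV"

definition nilpotent_map :: "('v::zero \<Rightarrow> 'v) \<Rightarrow> bool" where
  "nilpotent_map f \<longleftrightarrow> (\<exists>n. f ^^ n = (\<lambda>_. 0))"


section \<open>The q-tetrahedron algebra\<close>

definition qint :: "'k::field \<Rightarrow> nat \<Rightarrow> 'k" where
  "qint q n = (q ^ n - inverse q ^ n) / (q - inverse q)"

definition cubic_serre :: "'k::field \<Rightarrow> ('g, 'k) free_alg \<Rightarrow> ('g, 'k) free_alg \<Rightarrow> ('g, 'k) free_alg" where
  "cubic_serre q a b =
     a ^ 3 * b - fscalar (qint q 3) * a ^ 2 * b * a + fscalar (qint q 3) * a * b * a ^ 2 - b * a ^ 3"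

text \<open>The numeral type \<open>4\<close> is the ring of integers modulo 4.\<close>

typedef tetra_gen = "{(i :: 4, j :: 4). j - i = 1 \<or> j - i = 2}"
  by (rule exI[of _ "(0, 1)"]) simp

text \<open>For \<open>j - i\<close> not 1 or 2 the value is junk; \<open>tgen\<close> and \<open>tetra_x\<close> are only used where it is.\<close>

definition tgen :: "4 \<Rightarrow> 4 \<Rightarrow> (tetra_gen, 'k::field) free_alg" where
  "tgen i j = fgen (Abs_tetra_gen (i, j))"

definition tetra_relators :: "'k::field \<Rightarrow> (tetra_gen, 'k) free_alg set" where
  "tetra_relators q =
     {tgen i j * tgen j i - 1 | i j. j - i = 2} \<union>
     {fscalar (inverse (q - inverse q)) *
        (fscalar q * tgen h i * tgen i j - fscalar (inverse q) * tgen i j * tgen h i) - 1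
      | h i j. (i - h, j - i) \<in> {(1, 1), (1, 2), (2, 1)}} \<union>
     {cubic_serre q (tgen h i) (tgen j k)
      | h i j k. i - h = 1 \<and> j - i = 1 \<and> k - j = 1}"

definition tetra_algebra :: "'k::field \<Rightarrow> ('k, (tetra_gen, 'k) free_alg set) module" where
  "tetra_algebra q = presented_algebra (tetra_relators q)"

definition tetra_x :: "'k::field \<Rightarrow> 4 \<Rightarrow> 4 \<Rightarrow> (tetra_gen, 'k) free_alg set" where
  "tetra_x q i j = presented_gen (tetra_relators q) (Abs_tetra_gen (i, j))"

definition tetra_module_type ::
  "'k::field \<Rightarrow> ('k \<Rightarrow> 'v::ab_group_add \<Rightarrow> 'v) \<Rightarrow> ((tetra_gen, 'k) free_alg set \<Rightarrow> 'v \<Rightarrow> 'v) \<Rightarrow> 'k \<Rightarrow> bool" where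
  "tetra_module_type q scale act \<epsilon> \<longleftrightarrow>
     \<epsilon> \<in> {1, - 1} \<and>
     (\<exists>d::nat. \<forall>i j. j - i = 1 \<or> j - i = 2 \<longrightarrow>
        diagonalizable scale (act (tetra_x q i j)) \<and>
        eigenvalues scale (act (tetra_x q i j)) = {\<epsilon> * q powi (int d - 2 * int n) | n. n \<le> d})"


section \<open>The algebra of the cubic q-Serre relations\<close>

datatype Aq_gen = Gx | Gy

definition Aq_relators :: "'k::field \<Rightarrow> (Aq_gen, 'k) free_alg set" where
  "Aq_relators q = {cubic_serre q (fgen Gx) (fgen Gy), cubic_serre q (fgen Gy) (fgen Gx)}"

definition Aq_algebra :: "'k::field \<Rightarrow> ('k, (Aq_gen, 'k) free_alg set) module" where
  "Aq_algebra q = presented_algebra (Aq_relators q)"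

definition Aq_x :: "'k::field \<Rightarrow> (Aq_gen, 'k) free_alg set" where
  "Aq_x q = presented_gen (Aq_relators q) Gx"

definition Aq_y :: "'k::field \<Rightarrow> (Aq_gen, 'k) free_alg set" where
  "Aq_y q = presented_gen (Aq_relators q) Gy"

definition NonNil :: "'k::field \<Rightarrow> ((Aq_gen, 'k) free_alg set \<Rightarrow> 'v::ab_group_add \<Rightarrow> 'v) \<Rightarrow> bool" where
  "NonNil q act \<longleftrightarrow> \<not> nilpotent_map (act (Aq_x q)) \<and> \<not> nilpotent_map (act (Aq_y q))"

definition Aq_module_type ::
  "'k::field \<Rightarrow> ('k \<Rightarrow> 'v::ab_group_add \<Rightarrow> 'v) \<Rightarrow> ((Aq_gen, 'k) free_alg set \<Rightarrow> 'v \<Rightarrow> 'v) \<Rightarrow> 'k \<times> 'k \<Rightarrow> bool" where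
  "Aq_module_type q scale act = (\<lambda>(\<alpha>, \<alpha>').
     \<alpha> \<noteq> 0 \<and> \<alpha>' \<noteq> 0 \<and>
     diagonalizable scale (act (Aq_x q)) \<and> diagonalizable scale (act (Aq_y q)) \<and>
     (\<exists>d::nat.
        eigenvalues scale (act (Aq_x q)) = {\<alpha> * q powi (int d - 2 * int n) | n. n \<le> d} \<and>
        eigenvalues scale (act (Aq_y q)) = {\<alpha>' * q powi (int d - 2 * int n) | n. n \<le> d}))"

end

theory Submission
  imports Defs
begin

text \<open>
  Modules over an algebra given by generators and relations are operators on a space, one for each
  generator, that satisfy the relations (\<open>algebra_module_imp_rep\<close>, \<open>rep_imp_algebra_module\<close>,
  \<open>algebra_module_unique\<close>).  Two of the relations of the tetrahedron algebra are the cubic Serre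
  relations for \<open>x 0 1\<close> and \<open>x 2 3\<close>, so these operators define a unique module structure.  Its type is
  read off from the eigenvalues, none of which is zero, so neither operator is nilpotent.  The substance
  is irreducibility: a subspace invariant under \<open>x 0 1\<close> and \<open>x 2 3\<close> alone is \<open>{0}\<close> or everything.

  Write \<open>x i j\<close> for the operator of the generator with indices \<open>i\<close> and \<open>j\<close>, seen as an edge from \<open>i\<close> to
  \<open>j\<close>.  It has two flags, the sums of its first and of its last \<open>n\<close> eigenspaces, where the
  eigenvalues are ordered as \<open>q ^ d, q ^ (d - 2), \<dots>, q ^ (- d)\<close>.  The relation between \<open>x h i\<close> and \<open>x i j\<close>
  says that \<open>x i j\<close> is the inverse of \<open>x h i\<close> up to a map that shifts eigenspaces by one step.  Hence the
  flag of \<open>x h i\<close> read from the end is the flag of \<open>x i j\<close> read from the beginning (\<open>flag_eq_flag\<close>): all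
  operators at a vertex of the tetrahedron share one flag, and the flags of two vertices are opposite.

  Let \<open>W\<close> be nonzero and invariant under \<open>x 0 1\<close> and \<open>x 2 3\<close>.  For a vertex \<open>i\<close> let \<open>f i\<close> be the first step
  of its flag to meet \<open>W\<close> and \<open>e i\<close> the first one to contain \<open>W\<close>, counted from 0.  Since flags of distinct
  vertices are opposite, \<open>f i + e j \<ge> d\<close>, and equality holds for the edges 01 and 23 in both directions.
  From these inequalities alone it follows that \<open>f i + e j = d\<close> for all \<open>i \<noteq> j\<close>, and then \<open>W\<close> contains an
  eigenvector of every \<open>x i j\<close> (\<open>invariant_contains_eigenvector\<close>).  The eigenvectors of \<open>x i j\<close> in \<open>W\<close> span a
  subspace that is still invariant under \<open>x 0 1\<close> and \<open>x 2 3\<close> (\<open>span_eigs_invariant_01_23\<close>).  So if \<open>W\<close> is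
  minimal, then it is invariant under all the operators and therefore the whole module
  (\<open>minimal_invariant\<close>, \<open>irreducible_01_23\<close>).
\<close>

section \<open>Representations of a free algebra\<close>

lemma update_eq_add_single:
  "k \<notin> Poly_Mapping.keys f \<Longrightarrow> Poly_Mapping.update k c f = f + Poly_Mapping.single k c"
  by (intro poly_mapping_eqI)
    (auto simp: lookup_add lookup_update lookup_single when_def in_keys_iff)

lemma free_alg_induct [case_names scalar gen add mult]:
  fixes a :: "('g, 'k::field) free_alg"
  assumes scalar: "\<And>c. P (fscalar c)"
    and gen: "\<And>g. P (fgen g)"
    and add: "\<And>a b. P a \<Longrightarrow> P b \<Longrightarrow> P (a + b)"
    and mult: "\<And>a b. P a \<Longrightarrow> P b \<Longrightarrow> P (a * b)"
  shows "P a"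
proof -
  have word: "P (Poly_Mapping.single (Word gs) 1)" for gs :: "'g list"
  proof (induction gs)
    case Nil
    show ?case using scalar[of 1] by (simp add: fscalar_def zero_word_def)
  next
    case (Cons g gs)
    have "Poly_Mapping.single (Word (g # gs)) 1 = fgen g * Poly_Mapping.single (Word gs) (1::'k)"
      by (simp add: fgen_def mult_single plus_word_def)
    then show ?case using mult[OF gen Cons] by simp
  qed
  have monom: "P (Poly_Mapping.single w c)" for w :: "'g word" and c
  proof -
    obtain gs where w: "w = Word gs" by (cases w)
    have "Poly_Mapping.single w c = fscalar c * Poly_Mapping.single (Word gs) 1"
      by (simp add: w fscalar_def mult_single)
    then show ?thesis using mult[OF scalar word] by simp
  qed
  show ?thesis
  proof (induction a rule: update_induct)
    case const
    show ?case using scalar[of 0] by (simp add: fscalar_def)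
  next
    case (update f k c)
    show ?case using update(1) add[OF update(3) monom] by (simp add: update_eq_add_single)
  qed
qed

lemma linear_map_zero: "Vector_Spaces.linear s s' f \<Longrightarrow> f 0 = 0"
  using module_hom.zero[of s s' f] unfolding Vector_Spaces.linear_def by blast

text \<open>
  Working with operators on the space, rather than with cosets, turns every relation of a presented
  algebra into an identity between maps that the simplifier can evaluate.
\<close>

locale free_alg_rep = vector_space scale
  for scale :: "'k::field \<Rightarrow> 'v::ab_group_add \<Rightarrow> 'v"
    and \<phi> :: "('g, 'k) free_alg \<Rightarrow> 'v \<Rightarrow> 'v" +
  assumes lin: "Vector_Spaces.linear scale scale (\<phi> a)"
    and one: "\<phi> 1 = id"
    and mult: "\<phi> (a * b) = \<phi> a \<circ> \<phi> b"
    and add: "\<phi> (a + b) = (\<lambda>v. \<phi> a v + \<phi> b v)"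
    and scalar_mult: "\<phi> (fscalar c * a) = (\<lambda>v. scale c (\<phi> a v))"
begin

lemma diff: "\<phi> (a - b) = (\<lambda>v. \<phi> a v - \<phi> b v)"
  using add[of "a - b" b] by (simp add: fun_eq_iff algebra_simps)

lemma zero: "\<phi> 0 = (\<lambda>v. 0)"
  using diff[of 0 0] by simp

lemma scalar: "\<phi> (fscalar c) = scale c"
  using scalar_mult[of c 1] by (simp add: one)

lemma power: "\<phi> (a ^ n) = \<phi> a ^^ n"
  by (induction n) (simp_all add: one mult)

lemmas eval = lin one mult add diff zero scalar power

text \<open>
  Because of this, submodules need to be tested on generators only.
\<close>

lemma invariant_if_gens:
  assumes W: "subspace W" and gens: "\<And>g w. w \<in> W \<Longrightarrow> \<phi> (fgen g) w \<in> W" and "w \<in> W"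
  shows "\<phi> a w \<in> W"
  using \<open>w \<in> W\<close>
proof (induction a arbitrary: w rule: free_alg_induct)
  case (scalar c)
  then show ?case using W by (simp add: eval subspace_scale)
next
  case (gen g)
  then show ?case by (rule gens)
next
  case (add a b)
  then show ?case using W by (simp add: eval subspace_add)
next
  case (mult a b)
  then show ?case by (simp add: eval)
qed

end

text \<open>
  The source of the uniqueness of module structures: the operators of the generators can be
  propagated through sums and products.
\<close>

lemma free_alg_rep_unique:
  assumes "free_alg_rep scale \<phi>" "free_alg_rep scale \<psi>"
    and gens: "\<And>g. \<phi> (fgen g) = \<psi> (fgen g)"
  shows "\<phi> a = \<psi> a"
proof -
  interpret \<phi>: free_alg_rep scale \<phi> by fact
  interpret \<psi>: free_alg_rep scale \<psi> by fact
  show ?thesis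
    by (induction a rule: free_alg_induct) (simp_all add: \<phi>.eval \<psi>.eval gens)
qed

definition word_op :: "('g \<Rightarrow> 'v \<Rightarrow> 'v) \<Rightarrow> 'g word \<Rightarrow> 'v \<Rightarrow> 'v" where
  "word_op f w = foldr f (letters w)"

definition free_ext ::
  "('k::field \<Rightarrow> 'v::ab_group_add \<Rightarrow> 'v) \<Rightarrow> ('g \<Rightarrow> 'v \<Rightarrow> 'v) \<Rightarrow> ('g, 'k) free_alg \<Rightarrow> 'v \<Rightarrow> 'v" where
  "free_ext scale f a v =
     (\<Sum>w\<in>Poly_Mapping.keys a. scale (Poly_Mapping.lookup a w) (word_op f w v))"

context vector_space
begin

lemma free_ext_superset:
  assumes "finite A" "Poly_Mapping.keys a \<subseteq> A"
  shows "free_ext scale f a v = (\<Sum>w\<in>A. scale (Poly_Mapping.lookup a w) (word_op f w v))"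
  unfolding free_ext_def using assms
  by (intro sum.mono_neutral_left) (auto simp: in_keys_iff)

lemma free_ext_add: "free_ext scale f (a + b) v = free_ext scale f a v + free_ext scale f b v"
proof -
  let ?A = "Poly_Mapping.keys a \<union> Poly_Mapping.keys b"
  have "Poly_Mapping.keys (a + b) \<subseteq> ?A" by (rule Poly_Mapping.keys_add)
  then show ?thesis
    by (simp add: free_ext_superset[of ?A] lookup_add scale_left_distrib sum.distrib)
qed

lemma free_ext_single: "free_ext scale f (Poly_Mapping.single w c) v = scale c (word_op f w v)"
  by (simp add: free_ext_def)

lemma linear_word_op:
  assumes "\<And>g. Vector_Spaces.linear scale scale (f g)"
  shows "Vector_Spaces.linear scale scale (word_op f w)"
proof -
  have "Vector_Spaces.linear scale scale (foldr f gs)" for gs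
    using assms
  proof (induction gs)
    case Nil
    show ?case using linear_id by (simp add: id_def)
  next
    case (Cons g gs)
    show ?case
      using Vector_Spaces.linear_compose[OF Cons.IH[OF Cons.prems] Cons.prems[of g]] by (simp add: o_def)
  qed
  then show ?thesis by (simp add: word_op_def)
qed

lemma linear_free_ext:
  assumes "\<And>g. Vector_Spaces.linear scale scale (f g)"
  shows "Vector_Spaces.linear scale scale (free_ext scale f a)"
proof -
  note L = linear_word_op[of f, OF assms]
  have 1: "word_op f w (u + v) = word_op f w u + word_op f w v" for w u v
    using L[of w] by (simp add: Vector_Spaces.linear_iff)
  have 2: "word_op f w (scale c v) = scale c (word_op f w v)" for w c v
    using L[of w] by (simp add: Vector_Spaces.linear_iff)
  show ?thesis
    by (simp add: Vector_Spaces.linear_iff vector_space_axioms free_ext_def 1 2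
        scale_right_distrib sum.distrib scale_sum_right mult.commute)
qed

lemma word_op_plus: "word_op f (w + w') = word_op f w \<circ> word_op f w'"
  by (simp add: word_op_def plus_word_def fun_eq_iff)

text \<open>
  Multiplicativity is additive in each factor, which leaves the product of two words.
\<close>

lemma free_ext_mult:
  assumes "\<And>g. Vector_Spaces.linear scale scale (f g)"
  shows "free_ext scale f (a * b) v = free_ext scale f a (free_ext scale f b v)"
proof (induction a rule: update_induct)
  case const
  show ?case by (simp add: free_ext_def)
next
  case (update a k c)
  note upd = this
  have "free_ext scale f (Poly_Mapping.single k c * b) v = free_ext scale f (Poly_Mapping.single k c) (free_ext scale f b v)"
  proof (induction b rule: update_induct)
    case const
    show ?case
      by (simp add: free_ext_def linear_map_zero[OF linear_word_op[of f k, OF assms]])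
  next
    case (update b l e)
    have s: "Poly_Mapping.update l e b = b + Poly_Mapping.single l e"
      using update(1) by (rule update_eq_add_single)
    have W: "word_op f k (scale e u) = scale e (word_op f k u)" for u
      using linear_word_op[of f k, OF assms] by (simp add: Vector_Spaces.linear_iff)
    have A: "word_op f k (x + y) = word_op f k x + word_op f k y" for x y
      using linear_word_op[of f k, OF assms] by (simp add: Vector_Spaces.linear_iff)
    show ?case
      using update(3)
      by (simp add: s distrib_left free_ext_add mult_single free_ext_single word_op_plus W A
          scale_right_distrib)
  qed
  moreover have "Poly_Mapping.update k c a = a + Poly_Mapping.single k c"
    using upd(1) by (rule update_eq_add_single)
  ultimately show ?case
    using upd(3) by (simp add: distrib_right free_ext_add)
qed

lemma free_alg_rep_free_ext:
  assumes "\<And>g. Vector_Spaces.linear scale scale (f g)"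
  shows "free_alg_rep scale (free_ext scale f)"
proof unfold_locales
  show "free_ext scale f 1 = id"
    by (simp add: single_one[symmetric] free_ext_single word_op_def zero_word_def fun_eq_iff del: single_one)
  show "free_ext scale f (fscalar c * a) = (\<lambda>v. scale c (free_ext scale f a v))" for c a
    by (simp add: fun_eq_iff free_ext_mult[OF assms])
      (simp add: fscalar_def free_ext_single word_op_def zero_word_def)
qed (use assms linear_free_ext[of f, OF assms] in \<open>simp_all add: fun_eq_iff Vector_Spaces.linear_iff free_ext_mult free_ext_add\<close>)

lemma free_ext_gen: "free_ext scale f (fgen g) = f g"
  by (simp add: fgen_def free_ext_single word_op_def fun_eq_iff)

end


section \<open>Modules over an algebra given by generators and relations\<close>

text \<open>
  Stated for all unital rings, since free algebras are in general not commutative.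
\<close>

lemma ring_ring_of_type_algebra: "ring (ring_of_type_algebra :: 'a::ring_1 ring)"
proof -
  have "\<exists>y. x + y = 0" for x :: 'a
    using add.right_inverse by blast
  then show ?thesis
    unfolding ring_of_type_algebra_def using add.right_inverse
    by unfold_locales (auto simp: algebra_simps Units_def)
qed

lemma ideal_relator_ideal:
  "ideal (relator_ideal S) (ring_of_type_algebra :: ('g, 'k::field) free_alg ring)"
proof -
  interpret R: ring "ring_of_type_algebra :: ('g, 'k) free_alg ring"
    by (rule ring_ring_of_type_algebra)
  show ?thesis
    unfolding relator_ideal_def by (rule R.genideal_ideal) (simp add: ring_of_type_algebra_def)
qed

lemma relator_ideal_minimal:
  assumes "ideal I ring_of_type_algebra" "S \<subseteq> I"
  shows "relator_ideal S \<subseteq> I"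
proof -
  interpret I: ideal I ring_of_type_algebra by fact
  show ?thesis unfolding relator_ideal_def by (rule I.genideal_minimal) fact+
qed

lemma relators_in_ideal: "S \<subseteq> relator_ideal S"
proof -
  interpret R: ring "ring_of_type_algebra :: ('a, 'b) free_alg ring"
    by (rule ring_ring_of_type_algebra)
  show ?thesis unfolding relator_ideal_def
    by (rule R.genideal_self) (simp add: ring_of_type_algebra_def)
qed

lemma relator_class_eq: "relator_class S a = {i + a | i. i \<in> relator_ideal S}"
  by (auto simp: relator_class_def a_r_coset_def' ring_of_type_algebra_def)

lemma relator_class_eq_iff: "relator_class S a = relator_class S b \<longleftrightarrow> a - b \<in> relator_ideal S"
proof -
  interpret I: ideal "relator_ideal S" ring_of_type_algebra
    by (rule ideal_relator_ideal)
  have z: "0 \<in> relator_ideal S"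
    using additive_subgroup.zero_closed[OF I.is_additive_subgroup] by (simp add: ring_of_type_algebra_def)
  have p: "x + y \<in> relator_ideal S" if "x \<in> relator_ideal S" "y \<in> relator_ideal S" for x y
    using additive_subgroup.a_closed[OF I.is_additive_subgroup that] by (simp add: ring_of_type_algebra_def)
  have m: "- x \<in> relator_ideal S" if "x \<in> relator_ideal S" for x
    using I.I_l_closed[OF that, of "- 1"] by (simp add: ring_of_type_algebra_def)
  show ?thesis
  proof
    assume "relator_class S a = relator_class S b"
    moreover have "a \<in> relator_class S a" using z by (force simp: relator_class_eq)
    ultimately show "a - b \<in> relator_ideal S" by (auto simp: relator_class_eq)
  next
    assume d: "a - b \<in> relator_ideal S"
    have "i + a \<in> relator_class S b" if "i \<in> relator_ideal S" for i
      unfolding relator_class_eq using p[OF that d] by (auto intro!: exI[of _ "i + (a - b)"])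
    moreover have "i + b \<in> relator_class S a" if "i \<in> relator_ideal S" for i
      unfolding relator_class_eq using p[OF that m[OF d]] by (auto intro!: exI[of _ "i + (b - a)"])
    ultimately show "relator_class S a = relator_class S b"
      by (auto simp: relator_class_eq[of S a] relator_class_eq[of S b])
  qed
qed

lemma carrier_presented: "carrier (presented_algebra S) = range (relator_class S)"
  by (auto simp: presented_algebra_def ring.defs FactRing_def A_RCOSETS_def' relator_class_def
      ring_of_type_algebra_def)

lemma one_presented: "\<one>\<^bsub>presented_algebra S\<^esub> = relator_class S 1"
  by (simp add: presented_algebra_def ring.defs FactRing_def relator_class_def)
    (simp add: ring_of_type_algebra_def)

lemma mult_presented:
  "relator_class S a \<otimes>\<^bsub>presented_algebra S\<^esub> relator_class S b = relator_class S (a * b)"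
proof -
  interpret I: ideal "relator_ideal S" ring_of_type_algebra
    by (rule ideal_relator_ideal)
  show ?thesis
    using I.rcoset_mult_add[of a b]
    by (simp add: presented_algebra_def ring.defs FactRing_def relator_class_def)
      (simp add: ring_of_type_algebra_def)
qed

lemma add_presented:
  "relator_class S a \<oplus>\<^bsub>presented_algebra S\<^esub> relator_class S b = relator_class S (a + b)"
proof -
  interpret I: ideal "relator_ideal S" ring_of_type_algebra
    by (rule ideal_relator_ideal)
  show ?thesis
    using I.a_rcos_sum[of a b]
    by (simp add: presented_algebra_def ring.defs FactRing_def relator_class_def)
      (simp add: ring_of_type_algebra_def)
qed

text \<open>
  The scalar action is defined as a union over representatives; all of them give the same coset
  because a two-sided ideal absorbs the scalar, which is an element of the free algebra.
\<close>

lemma smult_presented: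
  "c \<odot>\<^bsub>presented_algebra S\<^esub> relator_class S a = relator_class S (fscalar c * a)"
proof -
  interpret I: ideal "relator_ideal S" ring_of_type_algebra
    by (rule ideal_relator_ideal)
  have "relator_class S (fscalar c * b) = relator_class S (fscalar c * a)"
    if "b \<in> relator_class S a" for b
  proof -
    from that obtain i where i: "i \<in> relator_ideal S" "b = i + a" by (auto simp: relator_class_eq)
    have "fscalar c * i \<in> relator_ideal S"
      using I.I_l_closed[OF i(1), of "fscalar c"] by (simp add: ring_of_type_algebra_def)
    then show ?thesis by (simp add: relator_class_eq_iff i(2) algebra_simps)
  qed
  moreover have "relator_class S a \<noteq> {}"
    using additive_subgroup.zero_closed[OF I.is_additive_subgroup] unfolding relator_class_eq by blast
  ultimately have "(\<Union>b\<in>relator_class S a. relator_class S (fscalar c * b)) = relator_class S (fscalar c * a)"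
    by auto
  then show ?thesis by (simp add: presented_algebra_def ring.defs module.defs)
qed

lemmas presented_simps =
  carrier_presented one_presented mult_presented add_presented smult_presented

text \<open>
  A module over a presented algebra is the same as a representation of the free algebra that kills
  the relators; the next lemmas are the two directions.
\<close>

lemma algebra_module_imp_rep:
  assumes "algebra_module (presented_algebra S) scale act"
  shows "free_alg_rep scale (\<lambda>a. act (relator_class S a))"
    and "s \<in> S \<Longrightarrow> act (relator_class S s) = (\<lambda>v. 0)"
proof -
  note A = assms[unfolded algebra_module_def presented_simps]
  show rep: "free_alg_rep scale (\<lambda>a. act (relator_class S a))"
    unfolding free_alg_rep_def free_alg_rep_axioms_def
    using A by (auto simp: presented_simps)
  assume "s \<in> S"
  then have "relator_class S s = relator_class S 0"
    using relators_in_ideal by (auto simp: relator_class_eq_iff)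
  then show "act (relator_class S s) = (\<lambda>v. 0)"
    using free_alg_rep.zero[OF rep] by simp
qed

text \<open>
  The elements acting as zero form a two-sided ideal.  If it contains the relators it contains the
  ideal that they generate, so the action is constant on cosets.
\<close>

lemma rep_imp_algebra_module:
  fixes \<phi> :: "('g, 'k::field) free_alg \<Rightarrow> 'v::ab_group_add \<Rightarrow> 'v"
  assumes rep: "free_alg_rep scale \<phi>" and S: "\<And>s. s \<in> S \<Longrightarrow> \<phi> s = (\<lambda>v. 0)"
  obtains act where "algebra_module (presented_algebra S) scale act"
    "\<And>a. act (relator_class S a) = \<phi> a"
proof -
  interpret free_alg_rep scale \<phi> by fact
  interpret R: ring "ring_of_type_algebra :: ('g, 'k) free_alg ring"
    by (rule ring_ring_of_type_algebra)
  let ?K = "{a. \<phi> a = (\<lambda>v. 0)}"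
  have L0: "\<phi> a 0 = 0" for a
    using lin[of a] by (rule linear_map_zero)
  have "ideal ?K ring_of_type_algebra"
  proof (rule idealI[OF R.ring_axioms])
    show "subgroup ?K (add_monoid (ring_of_type_algebra :: ('g, 'k) free_alg ring))"
    proof (rule R.add.subgroupI)
      show "?K \<noteq> {}" using zero by blast
      fix a assume a: "a \<in> ?K"
      have "\<ominus>\<^bsub>ring_of_type_algebra\<^esub> a = - a"
        by (rule R.minus_equality) (simp_all add: ring_of_type_algebra_def)
      then show "\<ominus>\<^bsub>ring_of_type_algebra\<^esub> a \<in> ?K"
        using a diff[of 0 a] by (simp add: zero)
    qed (auto simp: ring_of_type_algebra_def add)
  qed (auto simp: ring_of_type_algebra_def mult L0)
  then have "relator_ideal S \<subseteq> ?K" by (rule relator_ideal_minimal) (use S in blast)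
  then have wd: "\<phi> a = \<phi> b" if "relator_class S a = relator_class S b" for a b
    using that diff[of a b] by (fastforce simp: relator_class_eq_iff fun_eq_iff)
  define act where
    "act C = (if C \<in> range (relator_class S) then \<phi> (SOME a. C = relator_class S a) else undefined)" for C
  have act: "act (relator_class S a) = \<phi> a" for a
    unfolding act_def using someI[of "\<lambda>b. relator_class S a = relator_class S b" a]
    by (auto intro: wd)
  have "algebra_module (presented_algebra S) scale act"
    unfolding algebra_module_def presented_simps
    using vector_space_axioms lin
    by (auto simp: act presented_simps eval scalar_mult PiE_def extensional_def)
      (auto simp: act_def)
  then show ?thesis using act that by blast
qed

lemma algebra_module_unique:
  fixes act :: "('g, 'k::field) free_alg set \<Rightarrow> 'v::ab_group_add \<Rightarrow> 'v"
  assumes "algebra_module (presented_algebra S) scale act"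
    and "algebra_module (presented_algebra S) scale act'"
    and "\<And>g. act (presented_gen S g) = act' (presented_gen S g)"
  shows "act = act'"
proof (rule PiE_ext)
  show "act \<in> carrier (presented_algebra S) \<rightarrow>\<^sub>E {f. Vector_Spaces.linear scale scale f}"
    "act' \<in> carrier (presented_algebra S) \<rightarrow>\<^sub>E {f. Vector_Spaces.linear scale scale f}"
    using assms by (auto simp: algebra_module_def)
  fix C assume "C \<in> carrier (presented_algebra S)"
  then obtain a where "C = relator_class S a" by (auto simp: carrier_presented)
  then show "act C = act' C"
    using free_alg_rep_unique[OF algebra_module_imp_rep(1)[OF assms(1)]
        algebra_module_imp_rep(1)[OF assms(2)]] assms(3)
    by (simp add: presented_gen_def)
qed

lemma submodule_of_presented_iff:
  assumes "algebra_module (presented_algebra S) scale act"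
  shows "submodule_of (presented_algebra S) scale act W \<longleftrightarrow>
    module.subspace scale W \<and> (\<forall>g. \<forall>w\<in>W. act (presented_gen S g) w \<in> W)"
proof -
  interpret free_alg_rep scale "\<lambda>a. act (relator_class S a)"
    by (rule algebra_module_imp_rep) fact
  show ?thesis
    using invariant_if_gens[of W]
    by (auto simp: submodule_of_def carrier_presented presented_gen_def)
qed

section \<open>Flags of operators whose eigenvalues form a geometric progression\<close>

text \<open>
  The operator \<open>(A - c) (A - c r) \<dots> (A - c r ^ (n - 1))\<close>.  When these roots are
  distinct, its kernel is the sum of the eigenspaces for them; a kernel can be handled without
  decomposing vectors into eigenvectors.
\<close>

primrec geo_prod ::
  "('k::field \<Rightarrow> 'v::ab_group_add \<Rightarrow> 'v) \<Rightarrow> ('v \<Rightarrow> 'v) \<Rightarrow> 'k \<Rightarrow> 'k \<Rightarrow> nat \<Rightarrow> 'v \<Rightarrow> 'v" where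
  "geo_prod scale A c r 0 v = v"
| "geo_prod scale A c r (Suc n) v = geo_prod scale A c r n (A v - scale (c * r ^ n) v)"

text \<open>
  With \<open>p = q ^ (- 2)\<close> this is the relation \<open>(q A C - q ^ (- 1) C A) / (q - q ^ (- 1)) = 1\<close>, cleared of
  denominators so that exchanging \<open>A\<close> and \<open>C\<close> amounts to inverting \<open>p\<close>.
\<close>

definition q_commute :: "('k::field \<Rightarrow> 'v::ab_group_add \<Rightarrow> 'v) \<Rightarrow> 'k \<Rightarrow> ('v \<Rightarrow> 'v) \<Rightarrow> ('v \<Rightarrow> 'v) \<Rightarrow> bool" where
  "q_commute scale p A C \<longleftrightarrow> (\<forall>v. A (C v) = scale p (C (A v)) + scale (1 - p) v)"

text \<open>
  For an operator with the eigenvalues \<open>q ^ d, q ^ (d - 2), \<dots>, q ^ (- d)\<close> this is the sum of the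
  eigenspaces for the first \<open>n\<close> of them.  Replacing \<open>q\<close> by its inverse reads the list from the other end, so
  \<^term>\<open>flag scale (inverse q) d A n\<close> is the sum of the last \<open>n\<close> eigenspaces and every statement about
  one of the two flags of \<open>A\<close> gives one about the other.
\<close>

definition flag ::
  "('k::field \<Rightarrow> 'v::ab_group_add \<Rightarrow> 'v) \<Rightarrow> 'k \<Rightarrow> nat \<Rightarrow> ('v \<Rightarrow> 'v) \<Rightarrow> nat \<Rightarrow> 'v set" where
  "flag scale q d A n = {v. geo_prod scale A (q ^ d) (inverse q ^ 2) n v = 0}"

definition q_string ::
  "('k::field \<Rightarrow> 'v::ab_group_add \<Rightarrow> 'v) \<Rightarrow> 'k \<Rightarrow> nat \<Rightarrow> ('v \<Rightarrow> 'v) \<Rightarrow> bool" where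
  "q_string scale q d A \<longleftrightarrow> Vector_Spaces.linear scale scale A \<and> diagonalizable scale A \<and>
     eigenvalues scale A = {q ^ d * (inverse q ^ 2) ^ n | n. n \<le> d}"

text \<open>
  The progressions \<open>q ^ d, q ^ (d - 2), \<dots>\<close> and \<open>q ^ (- d), q ^ (2 - d), \<dots>\<close> list the same \<open>d + 1\<close> values
  from opposite ends.
\<close>

lemma q_power_reflect:
  fixes q :: "'k::field"
  assumes "q \<noteq> 0" "n + m = d"
  shows "inverse q ^ d * (inverse (inverse q) ^ 2) ^ m = q ^ d * (inverse q ^ 2) ^ n"
proof -
  define a b where "a = q ^ n" and "b = q ^ m"
  have "a \<noteq> 0" "b \<noteq> 0" using assms(1) by (simp_all add: a_def b_def)
  then have "inverse (a * b) * (b * b) = (a * b) * inverse (a * a)" by (simp add: field_simps)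
  moreover have "q ^ d = a * b" "(q ^ 2) ^ m = b * b" "(q ^ 2) ^ n = a * a"
    by (simp_all add: a_def b_def assms(2)[symmetric] power_add power2_eq_square power_mult_distrib)
  ultimately show ?thesis by (simp add: power_inverse)
qed

lemma q_string_inverse:
  fixes q :: "'k::field"
  assumes "q \<noteq> 0" "q_string scale q d A"
  shows "q_string scale (inverse q) d A"
proof -
  have "inverse q ^ d * (inverse (inverse q) ^ 2) ^ n = q ^ d * (inverse q ^ 2) ^ (d - n)" if "n \<le> d" for n
    using q_power_reflect[OF assms(1), of "d - n" n d] that by simp
  then have "{inverse q ^ d * (inverse (inverse q) ^ 2) ^ n | n. n \<le> d} = {q ^ d * (inverse q ^ 2) ^ (d - n) | n. n \<le> d}"
    by (metis (no_types, lifting))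
  also have "\<dots> = {q ^ d * (inverse q ^ 2) ^ n | n. n \<le> d}"
    by (auto intro: diff_le_self) (metis diff_diff_cancel diff_le_self)
  finally show ?thesis using assms(2) by (simp add: q_string_def)
qed

context vector_space
begin

lemma linear_map_diff: "Vector_Spaces.linear scale scale f \<Longrightarrow> f (x - y) = f x - f y"
  unfolding Vector_Spaces.linear_def using module_hom.diff by blast

lemma linear_map_scale: "Vector_Spaces.linear scale scale f \<Longrightarrow> f (scale c x) = scale c (f x)"
  unfolding Vector_Spaces.linear_iff by blast

lemma linear_map_add: "Vector_Spaces.linear scale scale f \<Longrightarrow> f (x + y) = f x + f y"
  unfolding Vector_Spaces.linear_iff by blast

lemmas linear_map_simps = linear_map_add linear_map_diff linear_map_scale linear_map_zero

lemma geo_prod_linear: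
  assumes "Vector_Spaces.linear scale scale A"
  shows "Vector_Spaces.linear scale scale (geo_prod scale A c r n)"
proof (induction n)
  case 0
  show ?case by (simp add: Vector_Spaces.linear_iff vector_space_axioms)
next
  case (Suc n)
  show ?case
    using assms Suc linear_map_diff[OF Suc] by (simp add: Vector_Spaces.linear_iff scale_right_distrib scale_right_diff_distrib mult.commute)
qed

lemma geo_prod_commute:
  assumes A: "Vector_Spaces.linear scale scale A"
  shows "A (geo_prod scale A c r n v) = geo_prod scale A c r n (A v)"
  by (induction n arbitrary: v) (simp_all add: linear_map_simps[OF A])

lemma geo_prod_Suc_outer:
  assumes A: "Vector_Spaces.linear scale scale A"
  shows "geo_prod scale A c r (Suc n) v =
    A (geo_prod scale A c r n v) - scale (c * r ^ n) (geo_prod scale A c r n v)"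
  by (simp add: geo_prod_commute[OF A] linear_map_simps[OF geo_prod_linear[OF A]])

lemma geo_prod_eigenvector:
  assumes A: "Vector_Spaces.linear scale scale A" and "A v = scale e v"
  shows "geo_prod scale A c r n v = scale (\<Prod>k<n. e - c * r ^ k) v"
  using assms(2)
  by (induction n)
    (simp_all add: scale_left_diff_distrib[symmetric] linear_map_simps[OF geo_prod_linear[OF A]] mult.commute)

text \<open>
  With \<open>f = e / p\<close>, the relation moves linear factors past each other:
  \<open>(A - e) (C - 1 / f) = p (C - 1 / e) (A - f)\<close>.
\<close>

lemma q_commute_exchange:
  assumes A: "Vector_Spaces.linear scale scale A" and C: "Vector_Spaces.linear scale scale C"
    and "q_commute scale p A C" "e \<noteq> 0" "f * p = e"
  shows "A (C w - scale (1 / f) w) - scale e (C w - scale (1 / f) w) =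
    scale p (C (A w - scale f w) - scale (1 / e) (A w - scale f w))"
proof -
  have "f \<noteq> 0" "p \<noteq> 0" using assms by auto
  have "A (C w - scale (1 / f) w) - scale e (C w - scale (1 / f) w) =
     scale p (C (A w)) + scale (1 - p) w - scale (1 / f) (A w) - scale e (C w) + scale (e / f) w"
    using assms(3)
    by (simp add: linear_map_simps[OF A] q_commute_def scale_right_diff_distrib)
  also have "\<dots> = scale p (C (A w)) + (scale (1 - p) w + scale p w) - scale (p / e) (A w) - scale (p * f) (C w)"
  proof -
    have "e / f = p" "p / e = 1 / f" "p * f = e"
      using assms(4,5) \<open>f \<noteq> 0\<close> \<open>p \<noteq> 0\<close> by (auto simp: field_simps)
    then show ?thesis by simp
  qed
  also have "scale (1 - p) w + scale p w = scale (p * f / e) w"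
    using assms(4,5) by (simp add: scale_left_distrib[symmetric] mult.commute)
  finally show ?thesis
    by (simp add: linear_map_simps[OF C] scale_right_diff_distrib algebra_simps)
qed

text \<open>
  A vector annihilated by the first \<open>n\<close> factors of \<open>A\<close> is annihilated by the corresponding factors of
  \<open>C\<close>, whose roots are the inverses.  Multiplying \<open>C - (1 / c) p ^ n\<close> by the lower factors of \<open>A\<close> and
  one additional factor \<open>A - c p\<close>, the exchange rule pushes \<open>C\<close> to the left and completes the product of
  factors of \<open>A\<close>, which is zero on the vector.  The additional factor is injective and can be
  cancelled, so induction applies to the vector after the last factor of \<open>C\<close>.
\<close>

lemma geo_prod_transfer:
  assumes A: "Vector_Spaces.linear scale scale A" and C: "Vector_Spaces.linear scale scale C"
    and com: "q_commute scale p A C" and nz: "p \<noteq> 0" "c \<noteq> 0"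
    and inj: "\<And>v. A v = scale (c * p) v \<Longrightarrow> v = 0"
    and "geo_prod scale A c (1 / p) n v = 0"
  shows "geo_prod scale C (1 / c) p n v = 0"
  using assms(7)
proof (induction n arbitrary: v)
  case 0
  then show ?case by simp
next
  case (Suc n)
  \<comment> \<open>the exchange rule, iterated through the whole product\<close>
  have *: "A (geo_prod scale A c (1 / p) n (C v - scale (1 / c * p ^ n) v))
       - scale (c * p) (geo_prod scale A c (1 / p) n (C v - scale (1 / c * p ^ n) v))
     = scale (p ^ Suc n) (C (geo_prod scale A c (1 / p) (Suc n) v)
         - scale (1 / (c * p)) (geo_prod scale A c (1 / p) (Suc n) v))" for v
  proof (induction n arbitrary: v)
    case 0
    show ?case using q_commute_exchange[OF A C com, of "c * p" c v] nz by simp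
  next
    case (Suc n)
    note G = linear_map_simps[OF geo_prod_linear[OF A]]
    have "A (C v - scale (1 / c * p ^ Suc n) v) - scale (c * (1 / p) ^ n) (C v - scale (1 / c * p ^ Suc n) v)
      = scale p (C (A v - scale (c * (1 / p) ^ Suc n) v) - scale (1 / c * p ^ n) (A v - scale (c * (1 / p) ^ Suc n) v))"
      using q_commute_exchange[OF A C com, of "c * (1 / p) ^ n" "c * (1 / p) ^ Suc n" v] nz
      by (simp add: field_simps)
    then have "geo_prod scale A c (1 / p) (Suc n) (C v - scale (1 / c * p ^ Suc n) v) =
      scale p (geo_prod scale A c (1 / p) n (C (A v - scale (c * (1 / p) ^ Suc n) v)
        - scale (1 / c * p ^ n) (A v - scale (c * (1 / p) ^ Suc n) v)))"
      by (simp only: geo_prod.simps G)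
    then show ?case
      using arg_cong[OF Suc.IH[of "A v - scale (c * (1 / p) ^ Suc n) v"], of "scale p"]
      by (simp add: linear_map_simps[OF A] scale_right_diff_distrib mult_ac del: power_Suc)
        (simp add: scale_right_diff_distrib mult_ac)
  qed
  have "geo_prod scale A c (1 / p) n (C v - scale (1 / c * p ^ n) v) = 0"
    by (rule inj) (use *[of v] Suc.prems in \<open>simp add: linear_map_simps[OF C] del: geo_prod.simps\<close>)
  from Suc.IH[OF this] show ?case by simp
qed

text \<open>
  The value one step beyond \<open>q ^ d\<close> is not an eigenvalue, since \<open>q\<close> is not a root of unity; it supplies
  the injective factor for the transfer of flags.
\<close>

lemma q_string_inj:
  assumes "q_string scale q d A" "q \<noteq> 0" "\<And>n::nat. n > 0 \<Longrightarrow> q ^ n \<noteq> 1"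
    and "A v = scale (q ^ d * q ^ 2) v"
  shows "v = 0"
proof (rule ccontr)
  assume "v \<noteq> 0"
  then have "q ^ d * q ^ 2 \<in> eigenvalues scale A" using assms(4) by (auto simp: eigenvalues_def)
  then obtain n where "q ^ d * q ^ 2 = q ^ d * (inverse q ^ 2) ^ n" using assms(1) by (auto simp: q_string_def)
  then have "q ^ (2 * Suc n) = 1"
    using assms(2) by (simp add: field_simps power_mult del: power_Suc) (simp add: power_mult[symmetric] power_add[symmetric] mult.commute)
  then show False using assms(3)[of "2 * Suc n"] by simp
qed

lemma flag_subset_flag:
  assumes str: "q_string scale q d A" "q_string scale q d C" and q: "q \<noteq> 0" "\<And>n::nat. n > 0 \<Longrightarrow> q ^ n \<noteq> 1"
    and "q_commute scale (inverse q ^ 2) A C"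
  shows "flag scale (inverse q) d A n \<subseteq> flag scale q d C n"
proof
  fix v assume v: "v \<in> flag scale (inverse q) d A n"
  have q': "(inverse q) ^ n \<noteq> 1" if "n > 0" for n
    using q(2)[OF that] by (simp add: power_inverse)
  have "geo_prod scale C (1 / inverse q ^ d) (inverse q ^ 2) n v = 0"
  proof (rule geo_prod_transfer[of A])
    show "v = 0" if "A v = scale (inverse q ^ d * inverse q ^ 2) v" for v
      by (rule q_string_inj[OF q_string_inverse[OF q(1) str(1)] _ q' that]) (use q in auto)
    show "geo_prod scale A (inverse q ^ d) (1 / inverse q ^ 2) n v = 0"
      using v by (simp add: flag_def field_simps)
  qed (use assms in \<open>auto simp: q_string_def\<close>)
  then show "v \<in> flag scale q d C n" by (simp add: flag_def field_simps)
qed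

lemma q_commute_swap:
  assumes "q_commute scale p A C" "p \<noteq> 0"
  shows "q_commute scale (inverse p) C A"
proof -
  have "scale (inverse p) (A (C v)) = C (A v) + scale (inverse p * (1 - p)) v" for v
    using assms by (simp add: q_commute_def scale_right_distrib)
  moreover have "scale (inverse p * (1 - p)) v + scale (1 - inverse p) v = 0" for v
    using assms(2) by (simp add: scale_left_distrib[symmetric] field_simps)
  ultimately show ?thesis by (simp add: q_commute_def add.assoc)
qed

text \<open>
  The hypotheses are symmetric under exchanging \<open>A\<close> and \<open>C\<close> and inverting \<open>q\<close>, so one inclusion gives both.
\<close>

lemma flag_eq_flag:
  assumes "q_string scale q d A" "q_string scale q d C" "q \<noteq> 0" "\<And>n::nat. n > 0 \<Longrightarrow> q ^ n \<noteq> 1"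
    and "q_commute scale (inverse q ^ 2) A C"
  shows "flag scale (inverse q) d A n = flag scale q d C n"
proof
  have "q_commute scale (inverse (inverse q) ^ 2) C A"
    using q_commute_swap[OF assms(5)] assms(3) by (simp add: power_inverse)
  moreover have "(inverse q) ^ n \<noteq> 1" if "n > 0" for n
    using assms(4)[OF that] by (simp add: power_inverse)
  ultimately show "flag scale q d C n \<subseteq> flag scale (inverse q) d A n"
    using flag_subset_flag[OF q_string_inverse[OF assms(3,2)] q_string_inverse[OF assms(3,1)]] assms(3)
    by simp
qed (rule flag_subset_flag[OF assms])

lemma flag_full:
  assumes "q_string scale q d A"
  shows "flag scale q d A (Suc d) = UNIV"
proof -
  have A: "Vector_Spaces.linear scale scale A" using assms by (simp add: q_string_def)
  note G = geo_prod_linear[OF A]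
  have "v \<in> flag scale q d A (Suc d)" if v: "A v = scale c v" for v c
  proof (cases "v = 0")
    case True
    then show ?thesis by (simp add: flag_def linear_map_simps[OF A] linear_map_simps[OF G])
  next
    case False
    then have "c \<in> eigenvalues scale A" using v by (auto simp: eigenvalues_def)
    then obtain n where "n \<le> d" "c = q ^ d * (inverse q ^ 2) ^ n" using assms by (auto simp: q_string_def)
    then have "(\<Prod>k<Suc d. c - q ^ d * (inverse q ^ 2) ^ k) = 0"
      by (auto intro!: bexI[of _ n])
    then show ?thesis
      unfolding flag_def by (simp add: geo_prod_eigenvector[OF A v] del: geo_prod.simps prod.lessThan_Suc)
  qed
  moreover have "subspace (flag scale q d A (Suc d))"
    unfolding subspace_def flag_def
    by (simp add: linear_map_simps[OF G] del: geo_prod.simps)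
  ultimately have "span {v. \<exists>c. A v = scale c v} \<subseteq> flag scale q d A (Suc d)"
    by (intro span_minimal) auto
  then show ?thesis using assms by (auto simp: q_string_def diagonalizable_def)
qed

text \<open>
  The two kernels belong to the first \<open>n\<close> and the last \<open>m\<close> of the \<open>d + 1\<close> distinct values
  \<open>q ^ d, q ^ (d - 2), \<dots>, q ^ (- d)\<close>, and these have none in common.
\<close>

lemma flag_opposite_zero:
  assumes A: "Vector_Spaces.linear scale scale A" and q: "q \<noteq> 0" "\<And>n::nat. n > 0 \<Longrightarrow> q ^ n \<noteq> 1"
    and "v \<in> flag scale q d A n" "v \<in> flag scale (inverse q) d A m" "n + m \<le> Suc d"
  shows "v = 0"
  using assms(4-)
proof (induction n arbitrary: v)
  case 0
  then show ?case by (simp add: flag_def)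
next
  case (Suc n)
  let ?e = "q ^ d * (inverse q ^ 2) ^ n"
  let ?u = "A v - scale ?e v"
  note G = linear_map_simps[OF geo_prod_linear[OF A]]
  have "?u = 0"
    using Suc.prems
    by (intro Suc.IH) (auto simp: flag_def G geo_prod_commute[OF A, symmetric] linear_map_simps[OF A])
  then have v: "A v = scale ?e v" by simp
  have "?e \<noteq> inverse q ^ d * (q ^ 2) ^ k" if "k < m" for k
  proof
    assume *: "?e = inverse q ^ d * (q ^ 2) ^ k"
    have "n + k \<le> d" using that Suc.prems(3) by linarith
    then obtain j where d: "d = n + k + j" using le_Suc_ex by blast
    have "?e = q ^ d * (inverse q ^ 2) ^ (n + j)"
      using * q_power_reflect[OF q(1), of "n + j" k d] by (simp add: d)
    then have "q ^ (2 * j) = 1"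
      using q(1) by (simp add: power_add power_mult power_inverse)
    then show False using q(2)[of "2 * j"] that Suc.prems(3) d by auto
  qed
  then have "(\<Prod>k<m. ?e - inverse q ^ d * (inverse (inverse q) ^ 2) ^ k) \<noteq> 0" by simp
  then show ?case
    using Suc.prems(2) by (simp add: flag_def geo_prod_eigenvector[OF A v])
qed

text \<open>
  Here the two lists of roots share exactly one value.  Its factor moves the vector into two flags
  without a common root, so the result is zero.
\<close>

lemma flag_opposite_eigenvector:
  assumes A: "Vector_Spaces.linear scale scale A" and q: "q \<noteq> 0" "\<And>n::nat. n > 0 \<Longrightarrow> q ^ n \<noteq> 1"
    and "v \<in> flag scale q d A (Suc n)" "v \<in> flag scale (inverse q) d A (Suc m)" "n + m = d"
  shows "A v = scale (q ^ d * (inverse q ^ 2) ^ n) v"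
proof -
  let ?u = "A v - scale (q ^ d * (inverse q ^ 2) ^ n) v"
  have "inverse q ^ d * (q ^ 2) ^ m = q ^ d * (inverse q ^ 2) ^ n"
    using q_power_reflect[OF q(1) assms(6)] by simp
  then have "?u \<in> flag scale (inverse q) d A m"
    using assms(5) by (simp add: flag_def)
  moreover have "?u \<in> flag scale q d A n" using assms(4) by (simp add: flag_def)
  ultimately have "?u = 0" using flag_opposite_zero[OF A q, of ?u d n m] assms(6) by linarith
  then show ?thesis by simp
qed

text \<open>
  Applying all factors but the last one that is needed to annihilate \<open>W\<close> produces an eigenvector
  for the last eigenvalue that occurs in \<open>W\<close>.
\<close>

lemma invariant_subspace_last_eigenvector:
  assumes A: "Vector_Spaces.linear scale scale A" and q: "q \<noteq> 0"
    and W: "subspace W" "\<And>w. w \<in> W \<Longrightarrow> A w \<in> W"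
    and n: "W \<subseteq> flag scale q d A (Suc n)" "\<not> W \<subseteq> flag scale q d A n" "n \<le> d"
  obtains u where "u \<in> W" "u \<noteq> 0" "u \<in> flag scale (inverse q) d A (Suc (d - n))"
proof -
  obtain w where w: "w \<in> W" "w \<notin> flag scale q d A n" using n(2) by blast
  let ?u = "geo_prod scale A (q ^ d) (inverse q ^ 2) n w"
  have inW: "geo_prod scale A c r k w \<in> W" if "w \<in> W" for c r k w
    using that by (induction k arbitrary: w) (auto intro!: W subspace_diff subspace_scale)
  have "geo_prod scale A (q ^ d) (inverse q ^ 2) (Suc n) w = 0" using w(1) n(1) by (auto simp: flag_def)
  then have eig: "A ?u - scale (q ^ d * (inverse q ^ 2) ^ n) ?u = 0" by (simp only: geo_prod_Suc_outer[OF A])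
  have "inverse q ^ d * (q ^ 2) ^ (d - n) = q ^ d * (inverse q ^ 2) ^ n"
    using q_power_reflect[OF q, of n "d - n" d] n(3) by simp
  then have "?u \<in> flag scale (inverse q) d A (Suc (d - n))"
    using eig by (simp add: flag_def linear_map_simps[OF geo_prod_linear[OF A]])
  moreover have "?u \<noteq> 0" using w(2) by (simp add: flag_def)
  ultimately show ?thesis using inW[OF w(1)] that by blast
qed

text \<open>
  If \<open>A w = c w\<close> then \<open>B w - w / c\<close> is again an eigenvector of \<open>A\<close>, for the eigenvalue \<open>p c\<close>, and it lies in
  \<open>W\<close> because \<open>B\<close> preserves \<open>W\<close>.
\<close>

lemma eigenvector_span_invariant:
  assumes W: "subspace W" "\<And>w. w \<in> W \<Longrightarrow> B w \<in> W" and B: "Vector_Spaces.linear scale scale B"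
    and A: "Vector_Spaces.linear scale scale A" and com: "q_commute scale p A B"
    and nz: "p \<noteq> 0" "0 \<notin> eigenvalues scale A"
    and w: "w \<in> span {w \<in> W. \<exists>c. A w = scale c w}"
  shows "B w \<in> span {w \<in> W. \<exists>c. A w = scale c w}"
proof -
  let ?E = "{w \<in> W. \<exists>c. A w = scale c w}"
  have "B w \<in> span ?E" if w: "w \<in> W" "A w = scale c w" for w c
  proof (cases "w = 0")
    case True
    then show ?thesis by (simp add: linear_map_simps[OF B] span_zero)
  next
    case False
    then have "c \<in> eigenvalues scale A" unfolding eigenvalues_def using w(2) by blast
    then have c: "c \<noteq> 0" using nz(2) by metis
    let ?u = "B w - scale (1 / c) w"
    have "A (B w) = scale (p * c) (B w) + scale (1 - p) w"
      using com w by (simp add: q_commute_def linear_map_simps[OF B])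
    then have "A ?u = scale (p * c) ?u"
      using w(2) c
      by (simp add: linear_map_simps[OF A] scale_right_diff_distrib scale_left_diff_distrib)
    moreover have "?u \<in> W" using W w by (auto intro!: subspace_diff subspace_scale)
    ultimately have "?u \<in> ?E" "w \<in> ?E" using w by blast+
    then have "?u + scale (1 / c) w \<in> span ?E"
      by (intro span_add span_scale span_base)
    then show ?thesis by simp
  qed
  moreover have "subspace {w. B w \<in> span ?E}"
    unfolding subspace_def by (auto simp: linear_map_simps[OF B] intro: span_zero span_add span_scale)
  ultimately have "span ?E \<subseteq> {w. B w \<in> span ?E}" by (intro span_minimal) auto
  then show ?thesis using w by blast
qed

end

section \<open>Four flags attached to the vertices of the tetrahedron\<close>

lemma Z4_cases: "i = 0 \<or> i = 1 \<or> i = 2 \<or> i = 3" for i :: 4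
proof (cases i rule: bit0.cases)
  case (1 z)
  then have "z = 0 \<or> z = 1 \<or> z = 2 \<or> z = 3" by auto
  with 1 show ?thesis by auto
qed

definition edge :: "4 \<Rightarrow> 4 \<Rightarrow> bool" where
  "edge i j \<longleftrightarrow> j - i = 1 \<or> j - i = 2"

lemma edge_linked: "i \<noteq> j \<Longrightarrow> edge i j \<or> edge j i"
  using Z4_cases[of i] Z4_cases[of j] by (auto simp: edge_def)

locale tetra_operators = finite_dimensional_vector_space scale Basis
  for scale :: "'k::field \<Rightarrow> 'v::ab_group_add \<Rightarrow> 'v" and Basis :: "'v set" +
  fixes q :: 'k and d :: nat and x :: "4 \<Rightarrow> 4 \<Rightarrow> 'v \<Rightarrow> 'v"
  assumes q: "q \<noteq> 0" "\<And>n::nat. n > 0 \<Longrightarrow> q ^ n \<noteq> 1"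
    and string: "edge i j \<Longrightarrow> q_string scale q d (x i j)"
    and inv: "j - i = 2 \<Longrightarrow> x i j (x j i v) = v"
    and rel: "(i - h, j - i) \<in> {(1, 1), (1, 2), (2, 1)} \<Longrightarrow>
      q_commute scale (inverse q ^ 2) (x h i) (x i j)"
begin

lemma lin: "edge i j \<Longrightarrow> Vector_Spaces.linear scale scale (x i j)"
  using string by (simp add: q_string_def)

text \<open>
  Two steps of length 2 lead back to the start; mutually inverse operators satisfy the same relation.
  Thus it holds along every path of two edges.
\<close>

lemma path_q_commute:
  assumes "edge h i" "edge i j"
  shows "q_commute scale (inverse q ^ 2) (x h i) (x i j)"
proof (cases "i - h = 2 \<and> j - i = 2")
  case True
  have "h - i = 2" using True Z4_cases[of h] Z4_cases[of i] by auto
  moreover have "j = h" using True Z4_cases[of h] Z4_cases[of i] Z4_cases[of j] by auto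
  ultimately show ?thesis
    using True inv by (simp add: q_commute_def scale_left_distrib[symmetric])
next
  case False
  then show ?thesis using assms rel by (auto simp: edge_def)
qed

text \<open>
  The flag of a vertex.  Every edge at the vertex gives the same flag, read from the beginning on an
  edge that leaves the vertex and from the end on one that enters it; the edge to the successor merely
  fixes a choice.
\<close>

definition vflag :: "4 \<Rightarrow> nat \<Rightarrow> 'v set" where
  "vflag i = flag scale q d (x i (i + 1))"

lemma vflag_in:
  assumes "edge h i"
  shows "flag scale (inverse q) d (x h i) n = vflag i n"
proof -
  have "edge i (i + 1)" by (simp add: edge_def)
  then show ?thesis
    unfolding vflag_def using assms
    by (intro flag_eq_flag string q path_q_commute) auto
qed

lemma vflag_out:
  assumes "edge i j"
  shows "flag scale q d (x i j) n = vflag i n"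
proof -
  have e: "edge (i - 1) i" by (simp add: edge_def)
  then have "flag scale (inverse q) d (x (i - 1) i) n = flag scale q d (x i j) n"
    using assms by (intro flag_eq_flag string q path_q_commute) auto
  then show ?thesis using vflag_in[OF e] by simp
qed

lemma vflag_full: "vflag i (Suc d) = UNIV"
  unfolding vflag_def by (rule flag_full) (simp add: string edge_def)

lemma vflag_0: "vflag i 0 = {0}"
  by (simp add: vflag_def flag_def)

text \<open>
  Distinct vertices are joined by an edge, whose operator has the two flags as its opposite flags.
\<close>

lemma vflags_opposite_zero:
  assumes "i \<noteq> j" "v \<in> vflag i n" "v \<in> vflag j m" "n + m \<le> Suc d"
  shows "v = 0"
proof (cases "edge i j")
  case True
  then show ?thesis
    using flag_opposite_zero[OF lin[OF True] q, of v d n m] assms by (simp add: vflag_in vflag_out)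
next
  case False
  then have "edge j i" using edge_linked[OF assms(1)] by simp
  then show ?thesis
    using flag_opposite_zero[OF lin q, of j i v d m n] assms by (simp add: vflag_in vflag_out)
qed

text \<open>
  Both indices are shifted by one: step \<open>n + 1\<close> of a flag is the first one that involves the
  eigenvalue \<open>q ^ (d - 2 n)\<close> of the operators on the edges leaving the vertex.
\<close>

definition fill_step :: "'v set \<Rightarrow> 4 \<Rightarrow> nat" where
  "fill_step W i = (LEAST n. W \<subseteq> vflag i (Suc n))"

definition meet_step :: "'v set \<Rightarrow> 4 \<Rightarrow> nat" where
  "meet_step W i = (LEAST n. \<exists>w\<in>W. w \<noteq> 0 \<and> w \<in> vflag i (Suc n))"

lemma fill_step_le: "fill_step W i \<le> d"
  unfolding fill_step_def by (rule Least_le) (simp add: vflag_full)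

lemma subset_fill_step: "W \<subseteq> vflag i (Suc (fill_step W i))"
  unfolding fill_step_def by (rule LeastI[of _ d]) (simp add: vflag_full)

lemma not_subset_before_fill_step:
  assumes "w \<in> W" "w \<noteq> 0"
  shows "\<not> W \<subseteq> vflag i (fill_step W i)"
proof (cases "fill_step W i")
  case 0
  then show ?thesis using assms by (auto simp: vflag_0)
next
  case (Suc n)
  then show ?thesis using not_less_Least[of n "\<lambda>n. W \<subseteq> vflag i (Suc n)"] by (simp add: fill_step_def)
qed

lemma meet_step_witness:
  assumes "w \<in> W" "w \<noteq> 0"
  obtains v where "v \<in> W" "v \<noteq> 0" "v \<in> vflag i (Suc (meet_step W i))"
proof -
  have "\<exists>w\<in>W. w \<noteq> 0 \<and> w \<in> vflag i (Suc (meet_step W i))"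
    unfolding meet_step_def by (rule LeastI[of _ d]) (use assms in \<open>auto simp: vflag_full\<close>)
  then show ?thesis using that by blast
qed

lemma meet_step_le: "w \<in> W \<Longrightarrow> w \<noteq> 0 \<Longrightarrow> w \<in> vflag i (Suc n) \<Longrightarrow> meet_step W i \<le> n"
  unfolding meet_step_def by (rule Least_le) blast

lemma meet_fill_ge:
  assumes "i \<noteq> j" "w \<in> W" "w \<noteq> 0"
  shows "d \<le> meet_step W i + fill_step W j"
proof (rule ccontr)
  assume *: "\<not> ?thesis"
  obtain v where "v \<in> W" "v \<noteq> 0" "v \<in> vflag i (Suc (meet_step W i))" using meet_step_witness assms(2,3) .
  then show False
    using vflags_opposite_zero[OF assms(1), of v "Suc (meet_step W i)" "Suc (fill_step W j)"] subset_fill_step[of W j] *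
    by auto
qed

text \<open>
  For an operator that preserves \<open>W\<close>, the last of its eigenvalues that occurs in \<open>W\<close>, counted from either
  end, has an eigenvector in \<open>W\<close>, and this lies in a small step of the opposite flag.
\<close>

lemma meet_fill_le:
  assumes "edge i j" and W: "subspace W" "\<And>w. w \<in> W \<Longrightarrow> x i j w \<in> W" and w: "w \<in> W" "w \<noteq> 0"
  shows "meet_step W j + fill_step W i \<le> d" "meet_step W i + fill_step W j \<le> d"
proof -
  note A = lin[OF assms(1)]
  have out: "flag scale q d (x i j) n = vflag i n" and into: "flag scale (inverse q) d (x i j) n = vflag j n" for n
    using assms(1) by (simp_all add: vflag_in vflag_out)
  obtain u where "u \<in> W" "u \<noteq> 0" "u \<in> vflag j (Suc (d - fill_step W i))"
    using invariant_subspace_last_eigenvector[OF A q(1) W, of d "fill_step W i"]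
      subset_fill_step[of W i] not_subset_before_fill_step[OF w, of i] fill_step_le[of W i]
    unfolding out into by metis
  then show "meet_step W j + fill_step W i \<le> d"
    using meet_step_le[of u W j "d - fill_step W i"] fill_step_le[of W i] by simp
  have "inverse q \<noteq> 0" using q(1) by simp
  then obtain u where "u \<in> W" "u \<noteq> 0" "u \<in> vflag i (Suc (d - fill_step W j))"
    using invariant_subspace_last_eigenvector[OF A _ W, of "inverse q" d "fill_step W j"]
      subset_fill_step[of W j] not_subset_before_fill_step[OF w, of j] fill_step_le[of W j]
    unfolding inverse_inverse_eq out into by metis
  then show "meet_step W i + fill_step W j \<le> d"
    using meet_step_le[of u W i "d - fill_step W j"] fill_step_le[of W j] by simp
qed

definition eigs :: "'v set \<Rightarrow> 4 \<Rightarrow> 4 \<Rightarrow> 'v set" where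
  "eigs W i j = {w \<in> W. \<exists>c. x i j w = scale c w}"

text \<open>
  For all pairs of distinct vertices, \<open>meet_step W i + fill_step W j \<ge> d\<close>, with
  equality on the edges 01 and 23, whose operators preserve \<open>W\<close>.  These linear conditions force all
  \<open>meet_step W i\<close> to be equal and all \<open>fill_step W j\<close> to be their complement in \<open>d\<close>, hence equality for every
  pair.  A nonzero vector of \<open>W\<close> in the first step of flag \<open>i\<close> that meets \<open>W\<close> then lies in two opposite
  flags that share a single eigenvalue.
\<close>

lemma invariant_contains_eigenvector:
  assumes W: "subspace W" "\<And>w. w \<in> W \<Longrightarrow> x 0 1 w \<in> W" "\<And>w. w \<in> W \<Longrightarrow> x 2 3 w \<in> W"
    and w: "w \<in> W" "w \<noteq> 0" and ij: "edge i j"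
  obtains v where "v \<in> eigs W i j" "v \<noteq> 0"
proof -
  have le: "meet_step W 1 + fill_step W 0 \<le> d" "meet_step W 0 + fill_step W 1 \<le> d"
    "meet_step W 3 + fill_step W 2 \<le> d" "meet_step W 2 + fill_step W 3 \<le> d"
    using meet_fill_le[of 0 1 W] meet_fill_le[of 2 3 W] assms by (auto simp: edge_def)
  have ge: "d \<le> meet_step W i + fill_step W j" if "i \<noteq> j" for i j
    using meet_fill_ge[OF that w] .
  have all: "d \<le> meet_step W 0 + fill_step W 1" "d \<le> meet_step W 0 + fill_step W 2" "d \<le> meet_step W 0 + fill_step W 3"
    "d \<le> meet_step W 1 + fill_step W 0" "d \<le> meet_step W 1 + fill_step W 2" "d \<le> meet_step W 1 + fill_step W 3"
    "d \<le> meet_step W 2 + fill_step W 0" "d \<le> meet_step W 2 + fill_step W 1" "d \<le> meet_step W 2 + fill_step W 3"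
    "d \<le> meet_step W 3 + fill_step W 0" "d \<le> meet_step W 3 + fill_step W 1" "d \<le> meet_step W 3 + fill_step W 2"
    by (rule ge; simp)+
  have "meet_step W 0 = meet_step W 1" "meet_step W 0 = meet_step W 2" "meet_step W 0 = meet_step W 3"
    "fill_step W 0 = d - meet_step W 0" "fill_step W 1 = d - meet_step W 0" "fill_step W 2 = d - meet_step W 0" "fill_step W 3 = d - meet_step W 0"
    "meet_step W 0 \<le> d"
    using le all by linarith+
  then have eq: "meet_step W i + fill_step W j = d"
    using Z4_cases[of i] Z4_cases[of j] by auto
  obtain v where v: "v \<in> W" "v \<noteq> 0" "v \<in> vflag i (Suc (meet_step W i))" using meet_step_witness[OF w] .
  have "x i j v = scale (q ^ d * (inverse q ^ 2) ^ meet_step W i) v"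
    using v subset_fill_step[of W j] ij
    by (intro flag_opposite_eigenvector[OF lin[OF ij] q _ _ eq]) (auto simp: vflag_in vflag_out)
  then show ?thesis using v that by (auto simp: eigs_def)
qed

lemma zero_not_eigenvalue: "edge i j \<Longrightarrow> 0 \<notin> eigenvalues scale (x i j)"
  using string[of i j] q(1) by (auto simp: q_string_def)

lemma span_eigs_invariant:
  assumes W: "subspace W" "\<And>w. w \<in> W \<Longrightarrow> x a b w \<in> W"
    and "edge i j" "edge a b" "j = a \<or> i = b" "w \<in> span (eigs W i j)"
  shows "x a b w \<in> span (eigs W i j)"
proof -
  have "\<exists>p. p \<noteq> 0 \<and> q_commute scale p (x i j) (x a b)"
  proof (cases "j = a")
    case True
    then show ?thesis using path_q_commute assms(3,4) q(1) by (intro exI[of _ "inverse q ^ 2"]) auto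
  next
    case False
    then have "i = b" using assms(5) by simp
    then show ?thesis
      using q_commute_swap[OF path_q_commute[of a b j]] assms(3,4) q(1)
      by (intro exI[of _ "inverse (inverse q ^ 2)"]) auto
  qed
  then show ?thesis
    using eigenvector_span_invariant[OF W lin[OF assms(4)] lin[OF assms(3)]]
      zero_not_eigenvalue[OF assms(3)] assms(6)
    unfolding eigs_def by blast
qed

lemma span_eigs_self:
  assumes "edge i j" "w \<in> span (eigs W i j)"
  shows "x i j w \<in> span (eigs W i j)"
proof -
  note A = linear_map_simps[OF lin[OF assms(1)]]
  have "subspace {w. x i j w \<in> span (eigs W i j)}"
    unfolding subspace_def by (auto simp: A intro: span_zero span_add span_scale)
  moreover have "eigs W i j \<subseteq> {w. x i j w \<in> span (eigs W i j)}"
  proof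
    fix w assume "w \<in> eigs W i j"
    moreover from this obtain c where "x i j w = scale c w" by (auto simp: eigs_def)
    ultimately show "w \<in> {w. x i j w \<in> span (eigs W i j)}" by (simp add: span_scale span_base)
  qed
  ultimately have "span (eigs W i j) \<subseteq> {w. x i j w \<in> span (eigs W i j)}" by (intro span_minimal)
  then show ?thesis using assms(2) by blast
qed

text \<open>
  The operators of opposite diagonals are inverse to each other, so they have the same eigenvectors.
\<close>

lemma eigs_opposite:
  assumes "j - i = 2"
  shows "eigs W i j = eigs W j i"
proof -
  have *: "eigs W i j \<subseteq> eigs W j i" if ij: "j - i = 2" for i j
  proof
    fix w assume "w \<in> eigs W i j"
    then obtain c where w: "w \<in> W" "x i j w = scale c w" by (auto simp: eigs_def)
    have ji: "i - j = 2" using ij Z4_cases[of i] Z4_cases[of j] by auto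
    then have "edge j i" by (simp add: edge_def)
    then have "scale c (x j i w) = w"
      using inv[OF ji, of w] w(2) linear_map_scale[OF lin] by simp
    then have "x j i w = scale (if c = 0 then 0 else 1 / c) w"
    proof (cases "c = 0")
      case True
      then have "w = 0" using \<open>scale c (x j i w) = w\<close> by simp
      then show ?thesis using linear_map_zero[OF lin[OF \<open>edge j i\<close>]] by simp
    next
      case False
      then have "x j i w = scale (1 / c) (scale c (x j i w))" by simp
      then show ?thesis using False \<open>scale c (x j i w) = w\<close> by simp
    qed
    then show "w \<in> eigs W j i" using w(1) by (auto simp: eigs_def)
  qed
  have "i - j = 2" using assms Z4_cases[of i] Z4_cases[of j] by auto
  then show ?thesis using *[OF assms] * by blast
qed

text \<open>
  Every edge other than 01 and 23 continues each of these two edges or leads into it, at least after a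
  diagonal is replaced by its reverse.
\<close>

lemma span_eigs_invariant_01_23:
  assumes W: "subspace W" "\<And>w. w \<in> W \<Longrightarrow> x a b w \<in> W"
    and ij: "edge i j" "(i, j) \<noteq> (0, 1)" "(i, j) \<noteq> (2, 3)"
    and ab: "(a, b) = (0, 1) \<or> (a, b) = (2, 3)"
    and w: "w \<in> span (eigs W i j)"
  shows "x a b w \<in> span (eigs W i j)"
proof (cases "j = a \<or> i = b")
  case True
  then show ?thesis using assms by (intro span_eigs_invariant) (auto simp: edge_def)
next
  case False
  then have *: "j - i = 2 \<and> edge j i \<and> (i = a \<or> j = b)"
    using ij ab Z4_cases[of i] Z4_cases[of j] by (auto simp: edge_def)
  then have "eigs W i j = eigs W j i" using eigs_opposite by blast
  then show ?thesis using assms * span_eigs_invariant[of W a b j i w] by (auto simp: edge_def)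
qed

text \<open>
  The eigenvectors of \<open>x i j\<close> in \<open>W\<close> span a nonzero subspace that is again invariant under \<open>x 0 1\<close> and
  \<open>x 2 3\<close>; by minimality it is \<open>W\<close>, on which \<open>x i j\<close> therefore acts.
\<close>

lemma minimal_invariant:
  assumes W: "subspace W" "\<And>w. w \<in> W \<Longrightarrow> x 0 1 w \<in> W" "\<And>w. w \<in> W \<Longrightarrow> x 2 3 w \<in> W" "W \<noteq> {0}"
    and minimal: "\<And>U. subspace U \<Longrightarrow> U \<subseteq> W \<Longrightarrow> U \<noteq> {0} \<Longrightarrow>
      (\<And>w. w \<in> U \<Longrightarrow> x 0 1 w \<in> U) \<Longrightarrow> (\<And>w. w \<in> U \<Longrightarrow> x 2 3 w \<in> U) \<Longrightarrow> U = W"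
    and ij: "edge i j" and w: "w \<in> W"
  shows "x i j w \<in> W"
proof (cases "(i, j) = (0, 1) \<or> (i, j) = (2, 3)")
  case True
  then show ?thesis using W w by auto
next
  case False
  let ?U = "span (eigs W i j)"
  obtain u where "u \<in> W" "u \<noteq> 0" using W(1,4) subspace_0 by blast
  then obtain v where v: "v \<in> eigs W i j" "v \<noteq> 0"
    using invariant_contains_eigenvector[OF W(1-3) _ _ ij] by blast
  have "?U = W"
  proof (rule minimal)
    show "?U \<subseteq> W" using W(1) by (intro span_minimal) (auto simp: eigs_def)
    show "?U \<noteq> {0}" using v span_base by blast
    show "x 0 1 w \<in> ?U" if "w \<in> ?U" for w
      by (rule span_eigs_invariant_01_23) (use W ij False that in auto)
    show "x 2 3 w \<in> ?U" if "w \<in> ?U" for w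
      by (rule span_eigs_invariant_01_23) (use W ij False that in auto)
  qed simp
  then show ?thesis using span_eigs_self[OF ij, of w W] w by simp
qed

text \<open>
  A nonzero subspace that is invariant under \<open>x 0 1\<close> and \<open>x 2 3\<close> contains one of minimal dimension, which
  is invariant under all the operators.
\<close>

lemma irreducible_01_23:
  assumes irr: "\<And>W. subspace W \<Longrightarrow> (\<And>i j w. edge i j \<Longrightarrow> w \<in> W \<Longrightarrow> x i j w \<in> W) \<Longrightarrow> W = {0} \<or> W = UNIV"
    and W: "subspace W" "\<And>w. w \<in> W \<Longrightarrow> x 0 1 w \<in> W" "\<And>w. w \<in> W \<Longrightarrow> x 2 3 w \<in> W"
  shows "W = {0} \<or> W = UNIV"
proof (rule disjCI)
  assume "W \<noteq> UNIV"
  define P where "P U \<longleftrightarrow> subspace U \<and> U \<subseteq> W \<and> U \<noteq> {0} \<and>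
    (\<forall>w\<in>U. x 0 1 w \<in> U) \<and> (\<forall>w\<in>U. x 2 3 w \<in> U)" for U
  show "W = {0}"
  proof (rule ccontr)
    assume "W \<noteq> {0}"
    then have "P W" using W by (auto simp: P_def)
    then obtain U where U: "P U" "\<And>U'. P U' \<Longrightarrow> dim U \<le> dim U'"
      using ex_has_least_nat[of P W dim] by blast
    have "x i j w \<in> U" if "edge i j" "w \<in> U" for i j w
    proof (rule minimal_invariant[OF _ _ _ _ _ that])
      fix U' assume *: "subspace U'" "U' \<subseteq> U" "U' \<noteq> {0}"
        "\<And>w. w \<in> U' \<Longrightarrow> x 0 1 w \<in> U'" "\<And>w. w \<in> U' \<Longrightarrow> x 2 3 w \<in> U'"
      then have "P U'" using U(1) by (auto simp: P_def)
      then show "U' = U" using U * by (intro subspace_dim_equal) (auto simp: P_def)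
    qed (use U(1) in \<open>auto simp: P_def\<close>)
    then have "U = {0} \<or> U = UNIV" using irr[of U] U(1) by (auto simp: P_def)
    then show False using U(1) \<open>W \<noteq> UNIV\<close> by (auto simp: P_def)
  qed
qed

end

section \<open>From tetrahedron modules to modules for the cubic Serre relations\<close>

lemma tetra_gen_cases:
  obtains i j where "edge i j" "g = Abs_tetra_gen (i, j)"
proof (cases g rule: Abs_tetra_gen_cases)
  case (Abs_tetra_gen y)
  then show ?thesis using that by (cases y) (auto simp: edge_def)
qed

lemma q_string_if_type:
  assumes "q \<noteq> 0" "Vector_Spaces.linear scale scale A" "diagonalizable scale A"
    and "eigenvalues scale A = {1 * q powi (int d - 2 * int n) | n. n \<le> d}"
  shows "q_string scale q d A"
proof -
  have "q powi (int d - 2 * int n) = q ^ d * (inverse q ^ 2) ^ n" for n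
    using assms(1) by (simp add: power_int_diff power_int_mult power_inverse divide_inverse)
  then show ?thesis using assms by (simp add: q_string_def)
qed

lemma q_commute_if_relator:
  fixes scale :: "'k::field \<Rightarrow> 'v::ab_group_add \<Rightarrow> 'v"
  assumes "vector_space scale" and q: "q \<noteq> 0" "q ^ 2 \<noteq> 1"
    and rel: "\<And>v. scale (inverse (q - inverse q)) (scale q (A (C v)) - scale (inverse q) (C (A v))) = v"
  shows "q_commute scale (inverse q ^ 2) A C"
  unfolding q_commute_def
proof
  fix v
  interpret vector_space scale by fact
  have ne: "q - inverse q \<noteq> 0" using q by (auto simp: field_simps power2_eq_square)
  have "scale q (A (C v)) - scale (inverse q) (C (A v)) = scale (q - inverse q) v"
    using arg_cong[OF rel[of v], of "scale (q - inverse q)"] ne by simp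
  then have "scale q (A (C v)) = scale (inverse q) (C (A v)) + scale (q - inverse q) v"
    by (simp add: algebra_simps)
  then have "scale (inverse q) (scale q (A (C v))) =
      scale (inverse q) (scale (inverse q) (C (A v)) + scale (q - inverse q) v)"
    by simp
  moreover have "inverse q * (q - inverse q) = 1 - inverse q ^ 2"
    using q(1) by (simp add: algebra_simps power2_eq_square)
  ultimately show "A (C v) = scale (inverse q ^ 2) (C (A v)) + scale (1 - inverse q ^ 2) v"
    using q(1) by (simp add: scale_right_distrib power2_eq_square)
qed

lemma tetra_module_operators:
  assumes q: "q \<noteq> 0" "\<forall>n::nat. n > 0 \<longrightarrow> q ^ n \<noteq> 1"
    and fin: "finite_dimensional_vector_space scale B"
    and alg: "algebra_module (tetra_algebra q) scale act"
    and d: "\<forall>i j. j - i = 1 \<or> j - i = 2 \<longrightarrow> diagonalizable scale (act (tetra_x q i j)) \<and>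
        eigenvalues scale (act (tetra_x q i j)) = {1 * q powi (int d - 2 * int n) | n. n \<le> d}"
  shows "tetra_operators scale B q d (\<lambda>i j. act (tetra_x q i j))"
proof -
  let ?\<phi> = "\<lambda>a. act (relator_class (tetra_relators q) a)"
  note alg' = alg[unfolded tetra_algebra_def]
  interpret finite_dimensional_vector_space scale B by fact
  interpret free_alg_rep scale ?\<phi> by (rule algebra_module_imp_rep) fact
  have x: "?\<phi> (tgen i j) = act (tetra_x q i j)" for i j
    by (simp add: tgen_def tetra_x_def presented_gen_def)
  note kill = algebra_module_imp_rep(2)[OF alg']
  show ?thesis
  proof unfold_locales
    show "q \<noteq> 0" by (rule q(1))
    show "q ^ n \<noteq> 1" if "n > 0" for n :: nat using q(2) that by simp
    show "q_string scale q d (act (tetra_x q i j))" if "edge i j" for i j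
    proof (rule q_string_if_type[OF q(1) lin[of "tgen i j", unfolded x]])
      have "j - i = 1 \<or> j - i = 2" using that by (simp add: edge_def)
      then show "diagonalizable scale (act (tetra_x q i j))"
        "eigenvalues scale (act (tetra_x q i j)) = {1 * q powi (int d - 2 * int n) | n. n \<le> d}"
        using d by blast+
    qed
    show "act (tetra_x q i j) (act (tetra_x q j i) v) = v" if "j - i = 2" for i j v
    proof -
      have "?\<phi> (tgen i j * tgen j i - 1) = (\<lambda>v. 0)"
        by (rule kill) (use that in \<open>auto simp: tetra_relators_def\<close>)
      then show ?thesis by (simp add: eval x fun_eq_iff)
    qed
    show "q_commute scale (inverse q ^ 2) (act (tetra_x q h i)) (act (tetra_x q i j))"
      if hij: "(i - h, j - i) \<in> {(1, 1), (1, 2), (2, 1)}" for h i j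
    proof (rule q_commute_if_relator)
      have "?\<phi> (fscalar (inverse (q - inverse q)) *
        (fscalar q * tgen h i * tgen i j - fscalar (inverse q) * tgen i j * tgen h i) - 1) = (\<lambda>v. 0)"
        by (rule kill) (use hij in \<open>unfold tetra_relators_def, blast\<close>)
      then show "scale (inverse (q - inverse q))
          (scale q (act (tetra_x q h i) (act (tetra_x q i j) v)) -
            scale (inverse q) (act (tetra_x q i j) (act (tetra_x q h i) v))) = v" for v
        by (simp add: eval x fun_eq_iff)
      show "q ^ 2 \<noteq> 1" using q(2) by simp
    qed (use q vector_space_axioms in auto)
  qed
qed

lemma cubic_serre_rep:
  assumes "free_alg_rep scale \<phi>" "free_alg_rep scale \<psi>" "\<phi> a = \<psi> a'" "\<phi> b = \<psi> b'"
  shows "\<phi> (cubic_serre q a b) = \<psi> (cubic_serre q a' b')"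
proof -
  interpret \<phi>: free_alg_rep scale \<phi> by fact
  interpret \<psi>: free_alg_rep scale \<psi> by fact
  show ?thesis by (simp add: cubic_serre_def \<phi>.eval \<psi>.eval assms(3,4))
qed

text \<open>
  The two defining relations are those of the tetrahedron algebra for the paths 0123 and 2301.
\<close>

lemma Aq_module_exists:
  assumes alg: "algebra_module (tetra_algebra q) scale act"
  obtains act' where "algebra_module (Aq_algebra q) scale act'"
    "act' (Aq_x q) = act (tetra_x q 0 1)" "act' (Aq_y q) = act (tetra_x q 2 3)"
proof -
  let ?\<phi> = "\<lambda>a. act (relator_class (tetra_relators q) a)"
  note alg' = alg[unfolded tetra_algebra_def]
  have rep: "free_alg_rep scale ?\<phi>" by (rule algebra_module_imp_rep) fact
  interpret free_alg_rep scale ?\<phi> by fact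
  have x: "?\<phi> (tgen i j) = act (tetra_x q i j)" for i j
    by (simp add: tgen_def tetra_x_def presented_gen_def)
  define \<psi> where "\<psi> = free_ext scale (case_Aq_gen (act (tetra_x q 0 1)) (act (tetra_x q 2 3)))"
  have rep': "free_alg_rep scale \<psi>"
    unfolding \<psi>_def
    by (rule free_alg_rep_free_ext) (use lin[of "tgen 0 1"] lin[of "tgen 2 3"] in \<open>simp add: x split: Aq_gen.split\<close>)
  have gens: "\<psi> (fgen Gx) = ?\<phi> (tgen 0 1)" "\<psi> (fgen Gy) = ?\<phi> (tgen 2 3)"
    by (simp_all add: \<psi>_def free_ext_gen x)
  have kill: "?\<phi> (cubic_serre q (tgen h i) (tgen j k)) = (\<lambda>v. 0)"
    if "i - h = 1" "j - i = 1" "k - j = 1" for h i j k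
    by (rule algebra_module_imp_rep(2)[OF alg']) (use that in \<open>unfold tetra_relators_def, blast\<close>)
  have "\<psi> s = (\<lambda>v. 0)" if "s \<in> Aq_relators q" for s
    using that cubic_serre_rep[OF rep' rep gens(1) gens(2)] cubic_serre_rep[OF rep' rep gens(2) gens(1)]
      kill[of 1 0 2 3] kill[of 3 2 0 1]
    by (auto simp: Aq_relators_def)
  then obtain act' where "algebra_module (Aq_algebra q) scale act'"
    "\<And>a. act' (relator_class (Aq_relators q) a) = \<psi> a"
    using rep_imp_algebra_module[OF rep'] unfolding Aq_algebra_def by metis
  then show ?thesis
    using that gens by (simp add: Aq_x_def Aq_y_def presented_gen_def x)
qed

lemma Aq_module_unique:
  assumes "algebra_module (Aq_algebra q) scale act" "algebra_module (Aq_algebra q) scale act'"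
    and "act (Aq_x q) = act' (Aq_x q)" "act (Aq_y q) = act' (Aq_y q)"
  shows "act = act'"
proof (rule algebra_module_unique[OF assms(1,2)[unfolded Aq_algebra_def]])
  show "act (presented_gen (Aq_relators q) g) = act' (presented_gen (Aq_relators q) g)" for g
    using assms(3,4) by (cases g) (simp_all add: Aq_x_def Aq_y_def)
qed

lemma not_nilpotent_map:
  assumes "vector_space scale" "Vector_Spaces.linear scale scale f" "c \<in> eigenvalues scale f" "c \<noteq> 0"
  shows "\<not> nilpotent_map f"
proof
  interpret vector_space scale by fact
  obtain v where v: "v \<noteq> 0" "f v = scale c v" using assms(3) by (auto simp: eigenvalues_def)
  have "(f ^^ n) v = scale (c ^ n) v" for n
    by (induction n) (simp_all add: v linear_map_scale[OF assms(2)] mult.commute)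
  moreover assume "nilpotent_map f"
  then obtain n where "f ^^ n = (\<lambda>_. 0)" unfolding nilpotent_map_def by blast
  then have "(f ^^ n) v = 0" by simp
  ultimately show False using v(1) assms(4) by simp
qed

theorem theorem10p3:
  fixes q :: "'k::alg_closed_field"
    and scale :: "'k \<Rightarrow> 'v::ab_group_add \<Rightarrow> 'v"
    and act :: "(tetra_gen, 'k) free_alg set \<Rightarrow> 'v \<Rightarrow> 'v"
  assumes "q \<noteq> 0"
    and "\<forall>n::nat. n > 0 \<longrightarrow> q ^ n \<noteq> 1"
    and "finite_dimensional scale"
    and "irreducible_module (tetra_algebra q) scale act"
    and "tetra_module_type q scale act 1"
  shows "(\<exists>!act'. algebra_module (Aq_algebra q) scale act' \<and>
             act' (Aq_x q) = act (tetra_x q 0 1) \<and>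
             act' (Aq_y q) = act (tetra_x q 2 3)) \<and>
         (\<forall>act'. algebra_module (Aq_algebra q) scale act' \<and>
             act' (Aq_x q) = act (tetra_x q 0 1) \<and>
             act' (Aq_y q) = act (tetra_x q 2 3) \<longrightarrow>
           NonNil q act' \<and>
           irreducible_module (Aq_algebra q) scale act' \<and>
           Aq_module_type q scale act' (1, 1))"
proof -
  have alg: "algebra_module (tetra_algebra q) scale act" and ne: "(UNIV :: 'v set) \<noteq> {0}"
    and irr: "\<And>W. submodule_of (tetra_algebra q) scale act W \<Longrightarrow> W = {0} \<or> W = UNIV"
    using assms(4) by (auto simp: irreducible_module_def)
  obtain B where fin: "finite_dimensional_vector_space scale B"
    using assms(3) by (auto simp: finite_dimensional_def)
  obtain d where d: "\<forall>i j. j - i = 1 \<or> j - i = 2 \<longrightarrow> diagonalizable scale (act (tetra_x q i j)) \<and>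
        eigenvalues scale (act (tetra_x q i j)) = {1 * q powi (int d - 2 * int n) | n. n \<le> d}"
    using assms(5) by (auto simp: tetra_module_type_def)
  interpret tetra_operators scale B q d "\<lambda>i j. act (tetra_x q i j)"
    by (rule tetra_module_operators[OF assms(1,2) fin alg d])
  have ops_irr: "W = {0} \<or> W = UNIV"
    if W: "subspace W" "\<And>i j w. edge i j \<Longrightarrow> w \<in> W \<Longrightarrow> act (tetra_x q i j) w \<in> W" for W
  proof (rule irr)
    have "act (presented_gen (tetra_relators q) g) w \<in> W" if "w \<in> W" for g w
      using W(2)[OF _ that] by (cases g rule: tetra_gen_cases) (auto simp: tetra_x_def)
    then show "submodule_of (tetra_algebra q) scale act W"
      using submodule_of_presented_iff[OF alg[unfolded tetra_algebra_def]] W(1)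
      by (simp add: tetra_algebra_def)
  qed
  have edges: "edge 0 1" "edge 2 3" by (simp_all add: edge_def)
  show ?thesis
  proof (intro conjI allI impI)
    show "\<exists>!act'. algebra_module (Aq_algebra q) scale act' \<and>
        act' (Aq_x q) = act (tetra_x q 0 1) \<and> act' (Aq_y q) = act (tetra_x q 2 3)"
      by (rule Aq_module_exists[OF alg]) (auto intro: Aq_module_unique)
  next
    fix act'
    assume "algebra_module (Aq_algebra q) scale act' \<and>
      act' (Aq_x q) = act (tetra_x q 0 1) \<and> act' (Aq_y q) = act (tetra_x q 2 3)"
    then have alg': "algebra_module (Aq_algebra q) scale act'"
      and xy: "act' (Aq_x q) = act (tetra_x q 0 1)" "act' (Aq_y q) = act (tetra_x q 2 3)" by auto
    have "\<not> nilpotent_map (act (tetra_x q i j))" if "edge i j" for i j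
      using not_nilpotent_map[OF vector_space_axioms lin[OF that], of "q ^ d"] string[OF that] q(1)
      by (force simp: q_string_def)
    then show "NonNil q act'" using edges by (simp add: NonNil_def xy)
    show "Aq_module_type q scale act' (1, 1)"
      using d by (auto simp: Aq_module_type_def xy intro!: exI[of _ d])
    have "W = {0} \<or> W = UNIV" if "submodule_of (Aq_algebra q) scale act' W" for W
    proof -
      have W: "subspace W" and
        g: "\<And>g w. w \<in> W \<Longrightarrow> act' (presented_gen (Aq_relators q) g) w \<in> W"
        using that submodule_of_presented_iff[OF alg'[unfolded Aq_algebra_def]]
        by (auto simp: Aq_algebra_def)
      show ?thesis
        by (rule irreducible_01_23[OF ops_irr W])
          (use g[of _ Gx] g[of _ Gy] xy in \<open>auto simp: Aq_x_def Aq_y_def\<close>)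
    qed
    then show "irreducible_module (Aq_algebra q) scale act'"
      using alg' ne by (simp add: irreducible_module_def)
  qed
qed

end
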